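(* Let $\mathfrak{g} = A_r = \mathfrak{sl}_{r+1}$. Let $\lambda$ be a dominant weight and write $\lambda = \omega_{i_1} + \cdots + \omega_{i_n}$ with $i_1 \leq \cdots \leq i_n$. Let $b \in \mathcal{B}(\lambda)$ and identify this element with a semistandard Young tableau $T$ (via the column identification described in the context). Then the right ends $\left( \mathsf{R}_{i_1}(b), \ldots, \mathsf{R}_{i_n}(b) \right)$ can be identified with the columns of the left key $K_-(T)$; that is, for each $k$, the right end $\mathsf{R}_{i_k}(b) \in \mathcal{B}(\omega_{i_k})$, viewed as a column of length $i_k$, is the column of length $i_k$ of $K_-(T)$.
   Context: **Crystals.** For a dominant weight $\lambda$, $\mathcal{B}(\lambda)$ is the (connected) Kashiwara crystal of the irreducible module of highest weight $\lambda$, with Kashiwara operators $\tilde E_i,\tilde F_i$ and $\varepsilon_i(b)=\max\{k:\tilde E_i^k b\neq 0\}$, $\varphi_i(b)=\max\{k:\tilde F_i^k b\neq0\}$. Tensor products use the convention: $\tilde E_i(b\otimes b')=\tilde E_i b\otimes b'$ if $\varphi_i(b)\ge\varepsilon_i(b')$ and $b\otimes\tilde E_i b'$ otherwise; $\tilde F_i(b\otimes b')=\tilde F_i b\otimes b'$ if $\varphi_i(b)>\varepsilon_i(b')$ and $b\otimes\tilde F_i b'$ otherwise. The Cartan component of $\mathcal{B}(\lambda_1)\otimes\cdots\otimes\mathcal{B}(\lambda_n)$ is its unique connected component isomorphic to $\mathcal{B}(\lambda_1+\cdots+\lambda_n)$. **Right ends.** For dominant $\lambda,\mu$ with $\lambda-\mu$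 dominant, $\mathsf{R}_\mu:\mathcal{B}(\lambda)\to\mathcal{B}(\mu)$ is $\mathsf{R}_\mu(b):=b''$, where $b\mapsto b'\otimes b''$ is the unique inclusion of crystals $\mathcal{B}(\lambda)\hookrightarrow\mathcal{B}(\lambda-\mu)\otimes\mathcal{B}(\mu)$ as the Cartan component. Write $\mathsf{R}_i:=\mathsf{R}_{\omega_i}$, with $\omega_i$ the fundamental weights. **Tableaux.** "Tableau" means semistandard Young tableau (entries in $\{1,\dots,r+1\}$, rows weakly increasing, columns strictly increasing). Elements of $\mathcal{B}(\omega_k)$ are identified with strictly increasing columns of length $k$ with entries in $\{1,\dots,r+1\}$, where $\tilde F_i$ replaces the entry $i$ by $i+1$ if $i$ occurs and $i+1$ does not, and is $0$ otherwise. For $\lambda=\omega_{i_1}+\cdots+\omega_{i_n}$ with $i_1\le\cdots\le i_n$, $\mathcal{B}(\lambda)$ is realized as the Cartan component of $\mathcal{B}(\omega_{i_1})\otimes\cdots\otimes\mathcal{B}(\omega_{i_n})$, and $b=C_1\otimes\cdots\otimes C_n$ (with $C_k$ a column of length $i_k$) is identified with the tableau $T$ whose columns from left to right are $C_n,\dots,C_1$. **Left key.** The rectification of a skew tableau is the tableau obtained from it by jeu de taquin slides. A skew tableau is frank if the lengths of its columns are, up to permutation, the lengths of the columns of its rectification. Let $T$ be a tableau with $n$ columns of lengths $(\ell_1,\dots,\ell_n)$. For each $i$ choose a frank skew tableau with rectification $T$ whose leftmost column has length $\ell_i$; this leftmost column $L_i(T)$ does not depend on the choice. The left key $K_-(T)$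 is the tableau of the same shape as $T$ with columns $L_1(T),\dots,L_n(T)$. *)

theory Defs
  imports "HOL-Library.Multiset" "HOL-Library.FuncSet"
begin

section \<open>Crystals of type A\<close>

text \<open>
  A weight of $A_r$ is written in the basis of fundamental weights: its value at $i$ is the
  pairing with the $i$-th simple coroot for $1 \le i \le r$, and $0$ for all other $i$.
\<close>

type_synonym weight = "nat \<Rightarrow> int"

definition fund :: "nat \<Rightarrow> weight" where
  "fund i = (\<lambda>j. if j = i then 1 else 0)"

definition dominant :: "nat \<Rightarrow> weight \<Rightarrow> bool" where
  "dominant r lam \<longleftrightarrow> (\<forall>i\<in>{1..r}. 0 \<le> lam i) \<and> (\<forall>i. i \<notin> {1..r} \<longrightarrow> lam i = 0)"

text \<open>
  \<open>None\<close> is the element $0$ adjoined to a crystal. Only the operators with index in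
  $\{1,\dots,r\}$ are meaningful; the rank is an argument of the notions that use them.
\<close>

record 'b crystal =
  carrier :: "'b set"
  wt :: "'b \<Rightarrow> weight"
  Eop :: "nat \<Rightarrow> 'b \<Rightarrow> 'b option"
  Fop :: "nat \<Rightarrow> 'b \<Rightarrow> 'b option"

definition iter :: "('b \<Rightarrow> 'b option) \<Rightarrow> nat \<Rightarrow> 'b \<Rightarrow> 'b option" where
  "iter f k b = ((\<lambda>x. Option.bind x f) ^^ k) (Some b)"

definition eps :: "'b crystal \<Rightarrow> nat \<Rightarrow> 'b \<Rightarrow> nat" where
  "eps X i b = Max {k. iter (Eop X i) k b \<noteq> None}"

definition phi :: "'b crystal \<Rightarrow> nat \<Rightarrow> 'b \<Rightarrow> nat" where
  "phi X i b = Max {k. iter (Fop X i) k b \<noteq> None}"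

definition tensor :: "'a crystal \<Rightarrow> 'b crystal \<Rightarrow> ('a \<times> 'b) crystal" where
  "tensor X Y = \<lparr>
     carrier = carrier X \<times> carrier Y,
     wt = (\<lambda>(b, b') j. wt X b j + wt Y b' j),
     Eop = (\<lambda>i (b, b'). if phi X i b \<ge> eps Y i b'
              then map_option (\<lambda>c. (c, b')) (Eop X i b)
              else map_option (\<lambda>c. (b, c)) (Eop Y i b')),
     Fop = (\<lambda>i (b, b'). if phi X i b > eps Y i b'
              then map_option (\<lambda>c. (c, b')) (Fop X i b)
              else map_option (\<lambda>c. (b, c)) (Fop Y i b')) \<rparr>"

text \<open>Transport of a crystal along a bijection \<open>f\<close> with inverse \<open>g\<close>.\<close>

definition transport :: "('a \<Rightarrow> 'b) \<Rightarrow> ('b \<Rightarrow> 'a) \<Rightarrow> 'a crystal \<Rightarrow> 'b crystal" where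
  "transport f g X = \<lparr>
     carrier = f ` carrier X,
     wt = (\<lambda>y. wt X (g y)),
     Eop = (\<lambda>i y. map_option f (Eop X i (g y))),
     Fop = (\<lambda>i y. map_option f (Fop X i (g y))) \<rparr>"

text \<open>
  The list $[b_1,\dots,b_n]$ stands for $b_1 \otimes (b_2 \otimes (\cdots \otimes b_n))$; the
  empty tensor product is the crystal of the trivial module.
\<close>

fun tensor_list :: "'a crystal list \<Rightarrow> 'a list crystal" where
  "tensor_list [] =
     \<lparr> carrier = {[]}, wt = (\<lambda>_ _. 0), Eop = (\<lambda>_ _. None), Fop = (\<lambda>_ _. None) \<rparr>"
| "tensor_list (X # Xs) =
     transport (\<lambda>(x, xs). x # xs) (\<lambda>ys. (hd ys, tl ys)) (tensor X (tensor_list Xs))"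

definition crystal_graph :: "nat \<Rightarrow> 'b crystal \<Rightarrow> ('b \<times> 'b) set" where
  "crystal_graph r X =
     {(b, c). b \<in> carrier X \<and> c \<in> carrier X \<and> (\<exists>i\<in>{1..r}. Fop X i b = Some c)}"

definition component :: "nat \<Rightarrow> 'b crystal \<Rightarrow> 'b \<Rightarrow> 'b set" where
  "component r X b = {c. (b, c) \<in> (crystal_graph r X \<union> (crystal_graph r X)\<inverse>)\<^sup>*}"

definition crystal_embedding ::
    "nat \<Rightarrow> 'a crystal \<Rightarrow> 'b crystal \<Rightarrow> ('a \<Rightarrow> 'b) \<Rightarrow> bool" where
  "crystal_embedding r X Y \<psi> \<longleftrightarrow>
     \<psi> \<in> carrier X \<rightarrow>\<^sub>E carrier Y \<and> inj_on \<psi> (carrier X) \<and>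
     (\<forall>b\<in>carrier X. wt Y (\<psi> b) = wt X b \<and>
        (\<forall>i\<in>{1..r}. Eop Y i (\<psi> b) = map_option \<psi> (Eop X i b) \<and>
                    Fop Y i (\<psi> b) = map_option \<psi> (Fop X i b)))"

subsection \<open>The crystals of highest weight\<close>

text \<open>A column is the list of its entries from top to bottom.\<close>

type_synonym column = "nat list"

definition column_crystal :: "nat \<Rightarrow> nat \<Rightarrow> column crystal" where
  "column_crystal r k = \<lparr>
     carrier = {C. length C = k \<and> sorted_wrt (<) C \<and> set C \<subseteq> {1..Suc r}},
     wt = (\<lambda>C j. if j \<in> {1..r} then of_bool (j \<in> set C) - of_bool (Suc j \<in> set C) else 0),
     Eop = (\<lambda>i C. if Suc i \<in> set C \<and> i \<notin> set C
              then Some (map (\<lambda>x. if x = Suc i then i else x) C) else None),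
     Fop = (\<lambda>i C. if i \<in> set C \<and> Suc i \<notin> set C
              then Some (map (\<lambda>x. if x = i then Suc i else x) C) else None) \<rparr>"

text \<open>
  The list $i_1 \le \cdots \le i_n$ with $\lambda = \omega_{i_1} + \cdots + \omega_{i_n}$,
  for a dominant weight $\lambda$.
\<close>

definition fund_indices :: "nat \<Rightarrow> weight \<Rightarrow> nat list" where
  "fund_indices r lam = concat (map (\<lambda>i. replicate (nat (lam i)) i) [1..<Suc r])"

text \<open>
  $\mathcal{B}(\lambda)$ is realized as the Cartan component of
  $\mathcal{B}(\omega_{i_1}) \otimes \cdots \otimes \mathcal{B}(\omega_{i_n})$. It is the component
  of the tensor product of the highest weight columns $(1,\dots,i_k)$, this being the only element
  of weight $\lambda = \omega_{i_1} + \cdots + \omega_{i_n}$. In particular the elements of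
  $\mathcal{B}(\omega_k)$ are the one-element lists \<open>[C]\<close>, with \<open>C\<close> a column of length $k$.
\<close>

definition hw_crystal :: "nat \<Rightarrow> weight \<Rightarrow> column list crystal" where
  "hw_crystal r lam =
     (let X = tensor_list (map (column_crystal r) (fund_indices r lam));
          u = map (\<lambda>k. [1..<Suc k]) (fund_indices r lam)
      in X\<lparr>carrier := component r X u\<rparr>)"

definition cartan_inclusion ::
    "nat \<Rightarrow> weight \<Rightarrow> weight \<Rightarrow> column list \<Rightarrow> column list \<times> column list" where
  "cartan_inclusion r lam mu =
     (let X = hw_crystal r lam;
          Y = tensor (hw_crystal r (\<lambda>j. lam j - mu j)) (hw_crystal r mu)
      in THE \<psi>. crystal_embedding r X Y \<psi> \<and>
           (\<exists>y\<in>carrier Y. \<psi> ` carrier X = component r Y y))"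

definition right_end :: "nat \<Rightarrow> weight \<Rightarrow> weight \<Rightarrow> column list \<Rightarrow> column list" where
  "right_end r lam mu b = snd (cartan_inclusion r lam mu b)"


section \<open>Skew tableaux and the left key\<close>

text \<open>
  Cells are pairs (row, column), both counted from $0$, with rows going downwards (English
  notation). A filling maps the cells of its shape to their entries.
\<close>

type_synonym cell = "nat \<times> nat"
type_synonym filling = "cell \<Rightarrow> nat option"

definition young_diagram :: "cell set \<Rightarrow> bool" where
  "young_diagram D \<longleftrightarrow> finite D \<and>
     (\<forall>i j i' j'. (i, j) \<in> D \<longrightarrow> i' \<le> i \<longrightarrow> j' \<le> j \<longrightarrow> (i', j') \<in> D)"

definition skew_shape :: "cell set \<Rightarrow> cell set \<Rightarrow> cell set \<Rightarrow> bool" where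
  "skew_shape D outer inner \<longleftrightarrow>
     young_diagram outer \<and> young_diagram inner \<and> inner \<subseteq> outer \<and> D = outer - inner"

definition skew_tableau :: "nat \<Rightarrow> filling \<Rightarrow> bool" where
  "skew_tableau r S \<longleftrightarrow>
     (\<exists>outer inner. skew_shape (dom S) outer inner) \<and>
     ran S \<subseteq> {1..Suc r} \<and>
     (\<forall>i j j' x y. S (i, j) = Some x \<longrightarrow> S (i, j') = Some y \<longrightarrow> j < j' \<longrightarrow> x \<le> y) \<and>
     (\<forall>i i' j x y. S (i, j) = Some x \<longrightarrow> S (i', j) = Some y \<longrightarrow> i < i' \<longrightarrow> x < y)"

text \<open>
  \<open>slide S c S'\<close>: moving the empty cell \<open>c\<close> through \<open>S\<close> until it has no neighbour to its right
  or below leads to \<open>S'\<close>. The smaller neighbour moves, and the lower one if they are equal.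
\<close>

inductive slide :: "filling \<Rightarrow> cell \<Rightarrow> filling \<Rightarrow> bool" where
  stop: "S (Suc i, j) = None \<Longrightarrow> S (i, Suc j) = None \<Longrightarrow> slide S (i, j) S"
| below: "S (Suc i, j) = Some x \<Longrightarrow> (\<And>y. S (i, Suc j) = Some y \<Longrightarrow> x \<le> y) \<Longrightarrow>
    slide (S((i, j) := Some x, (Suc i, j) := None)) (Suc i, j) S' \<Longrightarrow> slide S (i, j) S'"
| right: "S (i, Suc j) = Some y \<Longrightarrow> (\<And>x. S (Suc i, j) = Some x \<Longrightarrow> y < x) \<Longrightarrow>
    slide (S((i, j) := Some y, (i, Suc j) := None)) (i, Suc j) S' \<Longrightarrow> slide S (i, j) S'"

definition jdt_slide :: "filling \<Rightarrow> filling \<Rightarrow> bool" where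
  "jdt_slide S S' \<longleftrightarrow>
     (\<exists>outer inner c. skew_shape (dom S) outer inner \<and>
        c \<in> inner \<and> young_diagram (inner - {c}) \<and> slide S c S')"

definition rectifies_to :: "filling \<Rightarrow> filling \<Rightarrow> bool" where
  "rectifies_to S T \<longleftrightarrow> jdt_slide\<^sup>*\<^sup>* S T \<and> young_diagram (dom T)"

definition column_at :: "filling \<Rightarrow> nat \<Rightarrow> column" where
  "column_at S j = map (\<lambda>i. the (S (i, j))) (sorted_list_of_set {i. (i, j) \<in> dom S})"

text \<open>The nonempty columns from left to right; a skew shape may also have empty ones.\<close>

definition columns :: "filling \<Rightarrow> column list" where
  "columns S = map (column_at S) (sorted_list_of_set (snd ` dom S))"

definition of_columns :: "column list \<Rightarrow> filling" where
  "of_columns Cs =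
     (\<lambda>(i, j). if j < length Cs \<and> i < length (Cs ! j) then Some (Cs ! j ! i) else None)"

definition frank :: "filling \<Rightarrow> bool" where
  "frank S \<longleftrightarrow>
     (\<exists>T. rectifies_to S T \<and> mset (map length (columns S)) = mset (map length (columns T)))"

definition left_key_column :: "nat \<Rightarrow> filling \<Rightarrow> nat \<Rightarrow> column" where
  "left_key_column r T l =
     (THE C. \<exists>S. skew_tableau r S \<and> frank S \<and> rectifies_to S T \<and>
        C = hd (columns S) \<and> length C = l)"

definition left_key :: "nat \<Rightarrow> filling \<Rightarrow> filling" where
  "left_key r T = of_columns (map (\<lambda>C. left_key_column r T (length C)) (columns T))"

end

theory Submission
  imports Defs
begin

text \<open>
  Read a tableau column by column from right to left, each column from top to bottom. The tensor
  product rule then becomes the usual bracketing rule on words of letters, so every crystal that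
  occurs here is the crystal of words, restricted to a set of readings. Two facts about Knuth
  equivalence of words carry the proof. First, equivalent words have the same behaviour under
  all Kashiwara operators, and applying an operator to both gives equivalent words again
  (\<open>knuth_crystal_sim\<close>). Second, a jeu de taquin slide does not change the Knuth class of the
  reading (\<open>knuth_slide\<close>, \<open>slide_knuth\<close>).

  The highest weight words $(1 \dots i_1)(1 \dots i_2) \cdots (1 \dots i_n)$ for different orders of
  the $i_k$ are Knuth equivalent, because two such columns commute. In a tensor product of columns
  the highest weight word is determined by its content. Paths of Kashiwara operators can be followed
  in parallel on equivalent words, so Knuth equivalence is an isomorphism between the Cartan
  components of the tensor products in all orders (\<open>cartan_transfer\<close>, \<open>cartan_knuth_unique\<close>).
  In particular the inclusion of $\mathcal{B}(\lambda)$ into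
  $\mathcal{B}(\lambda - \omega_i) \otimes \mathcal{B}(\omega_i)$ sends $b$ to the only pair
  $x \otimes C$ with an equivalent reading, and the right end of $b$ is this column $C$
  (\<open>right_end_knuth\<close>).

  The same pair computes the left key. For existence, place $C$ and the columns of $x$
  in a skew shape in which no two columns share a row; its reading is that of $x \otimes C$, hence
  equivalent to $b$. Its rectification is a tableau equivalent to $b$, and such a tableau is
  $T$: following the path from $b$ to the highest weight element on both sides leads to a highest
  weight tableau of the right content, and there is only one (\<open>rectification_unique\<close>).
  So this skew tableau is frank with rectification $T$, and its leftmost column is $C$. For
  uniqueness, any frank skew tableau that rectifies to $T$ is, read by columns, an element of a
  Cartan component of the columns in some order, equivalent to $b$; splitting off its leftmost
  column gives an element equivalent to $x \otimes C$, so this column is $C$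
  (\<open>left_key_column_eq\<close>).
\<close>

section \<open>The crystal of words\<close>

text \<open>
  A word $x_1 \dots x_m$ stands for $x_1 \otimes \cdots \otimes x_m$ in the tensor power of the
  crystal $1 \to 2 \to 3 \to \cdots$ of letters; the recursions below are the tensor product rule
  with a single letter as left factor. In bracket terms $i$ opens, $i+1$ closes, and
  \<open>word_eps\<close> and \<open>word_phi\<close> count the unmatched $i+1$ and the unmatched $i$.
\<close>

fun word_eps :: "nat \<Rightarrow> nat list \<Rightarrow> nat" where
  "word_eps i [] = 0"
| "word_eps i (x # w) = (if x = Suc i then Suc (word_eps i w) else if x = i then word_eps i w - 1 else word_eps i w)"

fun word_phi :: "nat \<Rightarrow> nat list \<Rightarrow> nat" where
  "word_phi i [] = 0"
| "word_phi i (x # w) = (if x = i \<and> word_eps i w = 0 then Suc (word_phi i w) else word_phi i w)"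

fun word_E :: "nat \<Rightarrow> nat list \<Rightarrow> nat list option" where
  "word_E i [] = None"
| "word_E i (x # w) =
     (if x = Suc i \<and> word_eps i w = 0 then Some (i # w)
      else if x = i \<and> word_eps i w = 1 then None
      else map_option ((#) x) (word_E i w))"

fun word_F :: "nat \<Rightarrow> nat list \<Rightarrow> nat list option" where
  "word_F i [] = None"
| "word_F i (x # w) =
     (if x = i \<and> word_eps i w = 0 then Some (Suc i # w) else map_option ((#) x) (word_F i w))"

text \<open>
  The tensor product rule for an arbitrary left factor. Truncated subtraction is exactly the
  cancellation of the unmatched brackets of the two factors.
\<close>

lemma word_eps_append: "word_eps i (u @ v) = word_eps i u + (word_eps i v - word_phi i u)"
  by (induction u) auto

lemma word_phi_append: "word_phi i (u @ v) = word_phi i v + (word_phi i u - word_eps i v)"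
  by (induction u) (auto simp: word_eps_append)

lemma word_E_None_iff: "word_E i w = None \<longleftrightarrow> word_eps i w = 0"
  by (induction w) auto

lemma word_F_None_iff: "word_F i w = None \<longleftrightarrow> word_phi i w = 0"
  by (induction w) auto

lemma word_E_append:
  "word_E i (u @ v) = (if word_phi i u \<ge> word_eps i v then map_option (\<lambda>u'. u' @ v) (word_E i u)
                   else map_option (\<lambda>v'. u @ v') (word_E i v))"
proof (induction u)
  case Nil
  then show ?case using word_E_None_iff[of i v] by auto
next
  case (Cons x u)
  then show ?case
    using word_E_None_iff[of i v] word_E_None_iff[of i u]
    by (auto simp: word_eps_append option.map_comp comp_def)
qed

lemma word_F_append:
  "word_F i (u @ v) = (if word_phi i u > word_eps i v then map_option (\<lambda>u'. u' @ v) (word_F i u)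
                   else map_option (\<lambda>v'. u @ v') (word_F i v))"
proof (induction u)
  case (Cons x u)
  then show ?case
    using word_F_None_iff[of i u]
    by (auto simp: word_eps_append option.map_comp comp_def)
next
  case Nil
  show ?case by (cases "word_F i v") auto
qed

lemma word_E_Some: "word_E i w = Some w' \<Longrightarrow> word_eps i w = Suc (word_eps i w') \<and> word_phi i w' = Suc (word_phi i w)"
proof (induction w arbitrary: w')
  case (Cons x w)
  show ?case
  proof (cases "word_E i w")
    case None
    then show ?thesis using Cons.prems word_E_None_iff[of i w] by (auto split: if_splits)
  next
    case (Some v)
    then show ?thesis using Cons.prems Cons.IH[OF Some] by (auto split: if_splits)
  qed
qed simp

lemma word_F_Some: "word_F i w = Some w' \<Longrightarrow> word_eps i w' = Suc (word_eps i w) \<and> word_phi i w = Suc (word_phi i w')"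
proof (induction w arbitrary: w')
  case (Cons x w)
  show ?case
  proof (cases "word_F i w")
    case None
    then show ?thesis using Cons.prems by (auto split: if_splits)
  next
    case (Some v)
    then show ?thesis using Cons.prems Cons.IH[OF Some] by (auto split: if_splits)
  qed
qed simp

lemma word_E_imp_word_F: "word_E i w = Some w' \<Longrightarrow> word_F i w' = Some w"
proof (induction w arbitrary: w')
  case (Cons x w)
  show ?case
  proof (cases "word_E i w")
    case None
    then show ?thesis using Cons.prems word_E_None_iff[of i w] by (auto split: if_splits)
  next
    case (Some v)
    then show ?thesis using Cons.prems Cons.IH[OF Some] word_E_Some[OF Some] by (auto split: if_splits)
  qed
qed simp

lemma word_F_imp_word_E: "word_F i w = Some w' \<Longrightarrow> word_E i w' = Some w"
proof (induction w arbitrary: w')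
  case (Cons x w)
  show ?case
  proof (cases "word_F i w")
    case None
    then show ?thesis using Cons.prems by (auto split: if_splits)
  next
    case (Some v)
    then show ?thesis using Cons.prems Cons.IH[OF Some] word_F_Some[OF Some] by (auto split: if_splits)
  qed
qed simp

lemma word_E_iff_word_F: "word_E i w = Some w' \<longleftrightarrow> word_F i w' = Some w"
  using word_E_imp_word_F word_F_imp_word_E by blast

lemma word_eps_count: "word_eps i w + count (mset w) i = word_phi i w + count (mset w) (Suc i)"
  by (induction w) auto

section \<open>Knuth equivalence\<close>

text \<open>
  The plactic congruence. The two elementary relations are the mirror images of the usual ones,
  since columns are read here from top to bottom and tableaux from right to left.
\<close>

inductive knuth :: "nat list \<Rightarrow> nat list \<Rightarrow> bool" (infix "\<approx>" 50) where
  knuth_refl: "w \<approx> w"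
| knuth_sym: "u \<approx> v \<Longrightarrow> v \<approx> u"
| knuth_trans: "u \<approx> v \<Longrightarrow> v \<approx> w \<Longrightarrow> u \<approx> w"
| knuth_append: "u \<approx> u' \<Longrightarrow> v \<approx> v' \<Longrightarrow> u @ v \<approx> u' @ v'"
| knuth_yzx: "x \<le> y \<Longrightarrow> y < z \<Longrightarrow> [y, z, x] \<approx> [y, x, z]"
| knuth_xzy: "x < y \<Longrightarrow> y \<le> z \<Longrightarrow> [x, z, y] \<approx> [z, x, y]"

lemmas [trans] = knuth_trans

lemma knuth_mset: "u \<approx> v \<Longrightarrow> mset u = mset v"
  by (induction rule: knuth.induct) auto

definition "crystal_sim i u v \<longleftrightarrow> word_eps i u = word_eps i v \<and> word_phi i u = word_phi i v \<and>
   rel_option (\<approx>) (word_E i u) (word_E i v) \<and> rel_option (\<approx>) (word_F i u) (word_F i v)" for u v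

text \<open>
  Knuth equivalence is a bisimulation for the Kashiwara operators. It suffices to look at the
  elementary relations, where only the order of the three letters relative to $i$ and $i+1$
  matters; the append lemmas extend this to words in context.
\<close>

lemma knuth_crystal_sim: "u \<approx> v \<Longrightarrow> crystal_sim i u v"
proof (induction rule: knuth.induct)
  case (knuth_refl w)
  then show ?case unfolding crystal_sim_def by (simp add: option.rel_refl knuth.knuth_refl)
next
  case (knuth_sym u v)
  then show ?case unfolding crystal_sim_def
    by (auto simp: option_rel_Some1 option_rel_Some2 rel_option_iff split: option.splits intro: knuth.knuth_sym)
next
  case (knuth_trans u v w)
  then show ?case unfolding crystal_sim_def
    by (auto simp: rel_option_iff split: option.splits intro: knuth.knuth_trans)
next
  case (knuth_append u u' v v')
  then show ?case unfolding crystal_sim_def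
    by (auto simp: word_eps_append word_phi_append word_E_append word_F_append rel_option_iff
             split: option.splits intro: knuth.knuth_append)
next
  case (knuth_yzx x y z)
  show ?case using knuth_yzx unfolding crystal_sim_def
    by (cases "x = y") (auto intro: knuth.intros)
next
  case (knuth_xzy x y z)
  show ?case using knuth_xzy unfolding crystal_sim_def
    by (auto intro: knuth.intros)
qed

lemma knuth_cons: "u \<approx> v \<Longrightarrow> x # u \<approx> x # v"
  using knuth_append[OF knuth_refl[of "[x]"]] by simp

lemma knuth_append1: "u \<approx> v \<Longrightarrow> w @ u \<approx> w @ v"
  and knuth_append2: "u \<approx> v \<Longrightarrow> u @ w \<approx> v @ w"
  by (simp_all add: knuth_append knuth_refl)

text \<open>A letter that is at most the top entry of a column travels up the column to the second place.\<close>

lemma knuth_insert_left: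
  "sorted_wrt (<) (p # L) \<Longrightarrow> a \<le> p \<Longrightarrow> p # L @ [a] \<approx> p # a # L"
proof (induction L arbitrary: p)
  case Nil
  then show ?case by (simp add: knuth_refl)
next
  case (Cons l L)
  have "p # l # L @ [a] \<approx> p # l # a # L"
    by (rule knuth_cons, rule Cons.IH) (use Cons.prems in auto)
  also have "\<dots> \<approx> p # a # l # L"
    using knuth_append2[OF knuth_yzx[of a p l], of L] Cons.prems by simp
  finally show ?case by simp
qed

text \<open>
  The mirror image: a letter \<open>q\<close> that is at least every entry of a column travels down until it
  stands before the last entry. The entry after its neighbour serves as the witness that a Knuth
  relation needs.
\<close>

lemma knuth_insert_right:
  "sorted_wrt (<) (L @ [b]) \<Longrightarrow> b \<le> q \<Longrightarrow> q # L @ [b] \<approx> L @ [q, b]"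
proof (induction L)
  case Nil
  then show ?case by (simp add: knuth_refl)
next
  case (Cons l L)
  obtain n M where M: "L @ [b] = n # M" "n \<le> q" "l < n"
  proof (cases L)
    case Nil
    then show ?thesis using that Cons.prems by simp
  next
    case (Cons n M)
    then show ?thesis using that Cons.prems by simp
  qed
  have "q # l # n # M \<approx> l # q # n # M"
    using knuth_append2[OF knuth_sym[OF knuth_xzy[of l n q]], of M] M by simp
  also have "\<dots> \<approx> l # L @ [q, b]"
    unfolding M(1)[symmetric] by (rule knuth_cons, rule Cons.IH) (use Cons.prems in auto)
  finally show ?case using M(1) by simp
qed

text \<open>
  How \<open>y\<close> moves from the right column past the entries \<open>Q\<close> below it, into the left column.
  Each entry of \<open>Q\<close> is paired with the entry of \<open>B\<close> in its row; after the last entry of \<open>Q\<close> has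
  been moved down next to its partner, the rest is a smaller instance, and then it is moved back.
\<close>

lemma knuth_pass_below:
  assumes "list_all2 (\<le>) B Q" "sorted_wrt (<) (y # B)"
  shows "y # Q @ B @ B' \<approx> Q @ y # B @ B'"
  using assms
proof (induction Q arbitrary: B B' rule: rev_induct)
  case Nil
  then show ?case by (simp add: knuth_refl)
next
  case (snoc q Q)
  obtain C b where B: "B = C @ [b]" "list_all2 (\<le>) C Q" "b \<le> q"
    using snoc.prems(1) by (auto simp: list_all2_append2 list_all2_Cons2)
  have yB: "sorted_wrt (<) (y # C @ [b])" using snoc.prems(2) B(1) by simp
  have "y # Q @ q # C @ [b] @ B' \<approx> y # Q @ C @ [q, b] @ B'"
    using knuth_append1[OF knuth_append2[OF knuth_insert_right[of C b q]], of "y # Q" B'] yB B(3)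
    by simp
  also have "\<dots> \<approx> Q @ y # C @ [q, b] @ B'"
    by (rule snoc.IH[OF B(2)]) (use yB in \<open>auto simp: sorted_wrt_append\<close>)
  also have "\<dots> \<approx> Q @ q # y # C @ [b] @ B'"
    using knuth_append1[OF knuth_append2[OF knuth_sym[OF knuth_insert_right[of "y # C" b q]]], of Q B'] yB B(3)
    by simp
  finally show ?case using B(1) by simp
qed

text \<open>
  Adds the entries \<open>P\<close> and \<open>A\<close> above the hole. The top entry of \<open>A\<close> can be parked directly behind
  the top entry of \<open>P\<close>, its neighbour in the row; once all of \<open>A\<close> is parked, the letters \<open>y\<close>, \<open>Q\<close>
  and \<open>B\<close> are adjacent, and afterwards \<open>A\<close> returns.
\<close>

lemma knuth_pass_above:
  assumes "list_all2 (\<le>) A P" "sorted_wrt (<) (P @ y # Q)"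
    and "y # Q @ B \<approx> Q @ y # B"
  shows "P @ y # Q @ A @ B \<approx> P @ Q @ A @ y # B"
  using assms(1,2)
proof (induction A P rule: list_all2_induct)
  case Nil
  then show ?case using assms(3) by simp
next
  case (Cons a A p P)
  have "p # P @ y # Q @ a # A @ B \<approx> p # a # P @ y # Q @ A @ B"
    using knuth_append2[OF knuth_insert_left[of p "P @ y # Q" a], of "A @ B"] Cons by simp
  also have "\<dots> \<approx> p # a # P @ Q @ A @ y # B"
    by (rule knuth_cons, rule knuth_cons, rule Cons.IH) (use Cons.prems in simp)
  also have "\<dots> \<approx> p # P @ Q @ a # A @ y # B"
    using knuth_append2[OF knuth_sym[OF knuth_insert_left[of p "P @ Q" a]], of "A @ y # B"] Cons
    by (simp add: sorted_wrt_append)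
  finally show ?case by simp
qed

text \<open>
  A horizontal step of a slide, read by columns. The right column is \<open>P0 @ P @ y # Q\<close>, the
  left one has a hole between \<open>A\<close> and \<open>B @ B'\<close>, and \<open>y\<close> moves into the hole. The blocks
  \<open>A, P\<close> and \<open>B, Q\<close> occupy the same rows; \<open>P0\<close> sticks out at the top of the right column and \<open>B'\<close>
  at the bottom of the left one.
\<close>

theorem knuth_slide:
  assumes "list_all2 (\<le>) A P" "list_all2 (\<le>) B Q"
    and "sorted_wrt (<) (P @ y # Q)" "sorted_wrt (<) (y # B)"
  shows "(P0 @ P @ y # Q) @ (A @ B @ B') \<approx> (P0 @ P @ Q) @ (A @ y # B @ B')"
  using knuth_append1[OF knuth_pass_above[OF assms(1,3) knuth_pass_below[OF assms(2,4)]], of P0 B']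
  by simp

abbreviation hw_column :: "nat \<Rightarrow> column" where
  "hw_column k \<equiv> [1..<Suc k]"

text \<open>
  The surplus entries $a+1, \dots, b$ of the longer column pass the shorter column one at a time,
  the last one first.
\<close>

lemma hw_columns_commute: "hw_column a @ hw_column b \<approx> hw_column b @ hw_column a"
proof -
  have *: "hw_column b @ hw_column a \<approx> hw_column a @ hw_column b" if "a \<le> b" for a b
    using that
  proof (induction b rule: dec_induct)
    case base
    show ?case by (rule knuth_refl)
  next
    case (step b)
    let ?P = "[Suc (b - a)..<Suc b]"
    have split: "[1..<Suc (b - a)] @ ?P = hw_column b"
      using upt_add_eq_append[of 1 "Suc (b - a)" a] step by simp
    have "?P @ Suc b # [] @ hw_column a @ [] \<approx> ?P @ [] @ hw_column a @ Suc b # []"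
    proof (rule knuth_pass_above)
      show "list_all2 (\<le>) (hw_column a) ?P"
        using step by (auto simp: list_all2_conv_all_nth simp del: upt_Suc)
      show "sorted_wrt (<) (?P @ [Suc b])" by (simp add: sorted_wrt_append del: upt_Suc)
    qed (simp add: knuth_refl)
    from knuth_append1[OF this, of "[1..<Suc (b - a)]"]
    have "([1..<Suc (b - a)] @ ?P) @ Suc b # hw_column a \<approx>
        (([1..<Suc (b - a)] @ ?P) @ hw_column a) @ [Suc b]"
      by (simp only: append.simps append_assoc append_Nil2)
    then have "hw_column (Suc b) @ hw_column a \<approx> (hw_column b @ hw_column a) @ [Suc b]"
      unfolding split by simp
    also have "\<dots> \<approx> (hw_column a @ hw_column b) @ [Suc b]"
      by (rule knuth_append2) (rule step.IH)
    finally show ?case by simp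
  qed
  show ?thesis using knuth_sym[OF *[of a b]] *[of b a] by (cases "a \<le> b") (simp_all del: upt_Suc)
qed

abbreviation hw_word :: "nat list \<Rightarrow> nat list" where
  "hw_word ks \<equiv> concat (map hw_column ks)"

lemma hw_words_permute:
  "mset ks = mset ks' \<Longrightarrow> hw_word ks \<approx> hw_word ks'"
proof (induction ks arbitrary: ks')
  case Nil
  then show ?case by (simp add: knuth_refl)
next
  case (Cons k ks)
  have move: "hw_column k @ hw_word l \<approx> hw_word l @ hw_column k" for l
  proof (induction l)
    case (Cons a l)
    have "hw_column k @ hw_word (a # l) \<approx> (hw_column a @ hw_column k) @ hw_word l"
      using knuth_append2[OF hw_columns_commute[of k a], of "hw_word l"] by simp
    also have "\<dots> \<approx> hw_column a @ hw_word l @ hw_column k"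
      using knuth_append1[OF Cons] by simp
    finally show ?case by simp
  qed (simp add: knuth_refl)
  have "k \<in> set ks'" using Cons.prems by (metis list.set_intros(1) mset_eq_setD)
  then obtain l m where ks': "ks' = l @ k # m" by (meson split_list)
  then have "mset ks = mset (l @ m)" using Cons.prems by simp
  then have "hw_word (k # ks) \<approx> (hw_column k @ hw_word l) @ hw_word m"
    using knuth_append1[OF Cons.IH, of "l @ m" "hw_column k"] by simp
  also have "\<dots> \<approx> (hw_word l @ hw_column k) @ hw_word m"
    by (rule knuth_append2[OF move])
  finally show ?case using ks' by simp
qed

section \<open>Crystals modelled on words\<close>

definition word_wt :: "nat \<Rightarrow> nat list \<Rightarrow> weight" where
  "word_wt r w = (\<lambda>j. if j \<in> {1..r} then int (count (mset w) j) - int (count (mset w) (Suc j)) else 0)"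

text \<open>
  \<open>rd\<close> identifies \<open>X\<close> with a subset of the crystal of words that is closed under the operators.
  The common length of all readings makes the decomposition of a tensor product's reading into
  its factors unique, so that \<open>reads_tensor\<close> can conclude injectivity.
\<close>

definition reads :: "nat \<Rightarrow> 'b crystal \<Rightarrow> ('b \<Rightarrow> nat list) \<Rightarrow> bool" where
  "reads r X rd \<longleftrightarrow>
     inj_on rd (carrier X) \<and>
     (\<exists>n. \<forall>b\<in>carrier X. length (rd b) = n) \<and>
     (\<forall>b\<in>carrier X. wt X b = word_wt r (rd b) \<and>
        (\<forall>i\<in>{1..r}. map_option rd (Eop X i b) = word_E i (rd b) \<and> set_option (Eop X i b) \<subseteq> carrier X \<and>
                    map_option rd (Fop X i b) = word_F i (rd b) \<and> set_option (Fop X i b) \<subseteq> carrier X))"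

lemma iter_Suc: "iter f (Suc k) b = Option.bind (f b) (iter f k)"
proof -
  have "((\<lambda>x. Option.bind x f) ^^ k) None = None" for k by (induction k) auto
  then show ?thesis
    unfolding iter_def by (cases "f b") (simp_all add: funpow_Suc_right del: funpow.simps)
qed

text \<open>
  A statistic that drops by one with each application of \<open>f\<close> and vanishes exactly where \<open>f\<close> is
  undefined counts the possible applications.
\<close>

lemma Max_iter:
  assumes "\<And>b. b \<in> A \<Longrightarrow> f b = None \<longleftrightarrow> g b = (0::nat)"
    and "\<And>b c. b \<in> A \<Longrightarrow> f b = Some c \<Longrightarrow> c \<in> A \<and> g b = Suc (g c)"
    and "b \<in> A"
  shows "Max {k. iter f k b \<noteq> None} = g b"
proof -
  have "iter f k b \<noteq> None \<longleftrightarrow> k \<le> g b" if "b \<in> A" for k b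
    using that
  proof (induction k arbitrary: b)
    case 0
    then show ?case by (simp add: iter_def)
  next
    case (Suc k)
    then show ?case
      using assms(1)[OF Suc.prems] assms(2)[OF Suc.prems] by (cases "f b") (auto simp: iter_Suc)
  qed
  then have "{k. iter f k b \<noteq> None} = {..g b}" using assms(3) by auto
  then show ?thesis by (auto intro!: Max_eqI)
qed

context
  fixes r :: nat and X :: "'b crystal" and rd
  assumes X: "reads r X rd"
begin

lemma reads_inj: "b \<in> carrier X \<Longrightarrow> c \<in> carrier X \<Longrightarrow> rd b = rd c \<Longrightarrow> b = c"
  using X unfolding reads_def inj_on_def by blast

lemma reads_wt: "b \<in> carrier X \<Longrightarrow> wt X b = word_wt r (rd b)"
  using X unfolding reads_def by blast

lemma reads_E_Some:
  assumes "i \<in> {1..r}" "b \<in> carrier X"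
  shows "Eop X i b = Some c \<longleftrightarrow> c \<in> carrier X \<and> word_E i (rd b) = Some (rd c)"
proof -
  have *: "map_option rd (Eop X i b) = word_E i (rd b)" "set_option (Eop X i b) \<subseteq> carrier X"
    using X assms unfolding reads_def by auto
  then show ?thesis using reads_inj by (cases "Eop X i b") auto
qed

lemma reads_F_Some:
  assumes "i \<in> {1..r}" "b \<in> carrier X"
  shows "Fop X i b = Some c \<longleftrightarrow> c \<in> carrier X \<and> word_F i (rd b) = Some (rd c)"
proof -
  have *: "map_option rd (Fop X i b) = word_F i (rd b)" "set_option (Fop X i b) \<subseteq> carrier X"
    using X assms unfolding reads_def by auto
  then show ?thesis using reads_inj by (cases "Fop X i b") auto
qed

lemma reads_E_map: "i \<in> {1..r} \<Longrightarrow> b \<in> carrier X \<Longrightarrow> map_option rd (Eop X i b) = word_E i (rd b)"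
  and reads_F_map: "i \<in> {1..r} \<Longrightarrow> b \<in> carrier X \<Longrightarrow> map_option rd (Fop X i b) = word_F i (rd b)"
  using X unfolding reads_def by auto

lemma reads_eps:
  assumes i: "i \<in> {1..r}" and b: "b \<in> carrier X"
  shows "eps X i b = word_eps i (rd b)"
  unfolding eps_def
proof (rule Max_iter[where A = "carrier X"])
  fix b assume b: "b \<in> carrier X"
  show "Eop X i b = None \<longleftrightarrow> word_eps i (rd b) = 0"
    using reads_E_map[OF i b] word_E_None_iff[of i "rd b"] by (cases "Eop X i b") auto
  show "c \<in> carrier X \<and> word_eps i (rd b) = Suc (word_eps i (rd c))" if "Eop X i b = Some c" for c
    using that word_E_Some reads_E_Some[OF i b] by blast
qed (rule b)

lemma reads_phi:
  assumes i: "i \<in> {1..r}" and b: "b \<in> carrier X"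
  shows "phi X i b = word_phi i (rd b)"
  unfolding phi_def
proof (rule Max_iter[where A = "carrier X"])
  fix b assume b: "b \<in> carrier X"
  show "Fop X i b = None \<longleftrightarrow> word_phi i (rd b) = 0"
    using reads_F_map[OF i b] word_F_None_iff[of i "rd b"] by (cases "Fop X i b") auto
  show "c \<in> carrier X \<and> word_phi i (rd b) = Suc (word_phi i (rd c))" if "Fop X i b = Some c" for c
    using that word_F_Some reads_F_Some[OF i b] by blast
qed (rule b)

lemma reads_E_iff_F:
  assumes "i \<in> {1..r}" "b \<in> carrier X" "c \<in> carrier X"
  shows "Eop X i b = Some c \<longleftrightarrow> Fop X i c = Some b"
  using assms by (simp add: reads_E_Some reads_F_Some word_E_iff_word_F)

lemma reads_subcrystal:
  assumes "A \<subseteq> carrier X"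
    and "\<And>i b c. i \<in> {1..r} \<Longrightarrow> b \<in> A \<Longrightarrow> c \<in> carrier X \<Longrightarrow> Eop X i b = Some c \<Longrightarrow> c \<in> A"
    and "\<And>i b c. i \<in> {1..r} \<Longrightarrow> b \<in> A \<Longrightarrow> c \<in> carrier X \<Longrightarrow> Fop X i b = Some c \<Longrightarrow> c \<in> A"
  shows "reads r (X\<lparr>carrier := A\<rparr>) rd"
  unfolding reads_def
proof (intro conjI ballI)
  show "inj_on rd (carrier (X\<lparr>carrier := A\<rparr>))"
    using X assms(1) unfolding reads_def by (auto intro: inj_on_subset)
  show "\<exists>n. \<forall>b\<in>carrier (X\<lparr>carrier := A\<rparr>). length (rd b) = n"
    using X assms(1) unfolding reads_def by (auto 0 3)
  fix b assume "b \<in> carrier (X\<lparr>carrier := A\<rparr>)"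
  then have b: "b \<in> A" "b \<in> carrier X" using assms(1) by auto
  show "wt (X\<lparr>carrier := A\<rparr>) b = word_wt r (rd b)" using reads_wt b by simp
  fix i assume i: "i \<in> {1..r}"
  show "map_option rd (Eop (X\<lparr>carrier := A\<rparr>) i b) = word_E i (rd b)"
    "map_option rd (Fop (X\<lparr>carrier := A\<rparr>) i b) = word_F i (rd b)"
    using reads_E_map[OF i b(2)] reads_F_map[OF i b(2)] by simp_all
  show "set_option (Eop (X\<lparr>carrier := A\<rparr>) i b) \<subseteq> carrier (X\<lparr>carrier := A\<rparr>)"
    using assms(2)[OF i b(1)] reads_E_Some[OF i b(2)] by (cases "Eop X i b") auto
  show "set_option (Fop (X\<lparr>carrier := A\<rparr>) i b) \<subseteq> carrier (X\<lparr>carrier := A\<rparr>)"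
    using assms(3)[OF i b(1)] reads_F_Some[OF i b(2)] by (cases "Fop X i b") auto
qed

end

lemma reads_tensor:
  assumes X: "reads r X f" and Y: "reads r Y g"
  shows "reads r (tensor X Y) (\<lambda>(b, c). f b @ g c)"
proof -
  obtain n where n: "\<And>b. b \<in> carrier X \<Longrightarrow> length (f b) = n" using X unfolding reads_def by auto
  obtain m where m: "\<And>b. b \<in> carrier Y \<Longrightarrow> length (g b) = m" using Y unfolding reads_def by auto
  have E: "map_option (\<lambda>(b, c). f b @ g c) (Eop (tensor X Y) i (b, c)) = word_E i (f b @ g c)"
      "map_option (\<lambda>(b, c). f b @ g c) (Fop (tensor X Y) i (b, c)) = word_F i (f b @ g c)"
    if "i \<in> {1..r}" "b \<in> carrier X" "c \<in> carrier Y" for i b c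
    using that reads_E_map[OF X that(1,2)] reads_E_map[OF Y that(1,3)]
      reads_F_map[OF X that(1,2)] reads_F_map[OF Y that(1,3)]
    by (auto simp: tensor_def reads_phi[OF X] reads_eps[OF Y] word_E_append word_F_append
        option.map_comp comp_def simp flip: reads_E_map[OF X] reads_E_map[OF Y]
        reads_F_map[OF X] reads_F_map[OF Y])
  have S: "set_option (Eop (tensor X Y) i (b, c)) \<subseteq> carrier X \<times> carrier Y"
      "set_option (Fop (tensor X Y) i (b, c)) \<subseteq> carrier X \<times> carrier Y"
    if "i \<in> {1..r}" "b \<in> carrier X" "c \<in> carrier Y" for i b c
    using that by (auto simp: tensor_def reads_E_Some[OF X] reads_E_Some[OF Y]
        reads_F_Some[OF X] reads_F_Some[OF Y] elem_set split: if_splits)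
  show ?thesis unfolding reads_def
  proof (intro conjI)
    show "inj_on (\<lambda>(b, c). f b @ g c) (carrier (tensor X Y))"
      by (rule inj_onI) (use n in \<open>auto simp: tensor_def intro: reads_inj[OF X] reads_inj[OF Y]\<close>)
    show "\<exists>n. \<forall>b\<in>carrier (tensor X Y). length (case b of (b, c) \<Rightarrow> f b @ g c) = n"
      using n m by (intro exI[of _ "n + m"]) (auto simp: tensor_def)
    show "\<forall>b\<in>carrier (tensor X Y). wt (tensor X Y) b = word_wt r (case b of (b, c) \<Rightarrow> f b @ g c) \<and>
       (\<forall>i\<in>{1..r}. map_option (\<lambda>(b, c). f b @ g c) (Eop (tensor X Y) i b) = word_E i (case b of (b, c) \<Rightarrow> f b @ g c) \<and>
           set_option (Eop (tensor X Y) i b) \<subseteq> carrier (tensor X Y) \<and>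
           map_option (\<lambda>(b, c). f b @ g c) (Fop (tensor X Y) i b) = word_F i (case b of (b, c) \<Rightarrow> f b @ g c) \<and>
           set_option (Fop (tensor X Y) i b) \<subseteq> carrier (tensor X Y))"
    proof (clarify)
      fix b c assume "(b, c) \<in> carrier (tensor X Y)"
      then have bc: "b \<in> carrier X" "c \<in> carrier Y" by (auto simp: tensor_def)
      have "wt (tensor X Y) (b, c) = word_wt r (f b @ g c)"
        using reads_wt[OF X bc(1)] reads_wt[OF Y bc(2)] by (auto simp: tensor_def word_wt_def)
      moreover have "carrier (tensor X Y) = carrier X \<times> carrier Y" by (simp add: tensor_def)
      ultimately show "wt (tensor X Y) (b, c) = word_wt r (f b @ g c) \<and>
       (\<forall>i\<in>{1..r}. map_option (\<lambda>(b, c). f b @ g c) (Eop (tensor X Y) i (b, c)) = word_E i (f b @ g c) \<and>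
           set_option (Eop (tensor X Y) i (b, c)) \<subseteq> carrier (tensor X Y) \<and>
           map_option (\<lambda>(b, c). f b @ g c) (Fop (tensor X Y) i (b, c)) = word_F i (f b @ g c) \<and>
           set_option (Fop (tensor X Y) i (b, c)) \<subseteq> carrier (tensor X Y))"
        using E[OF _ bc] S[OF _ bc] by simp
    qed
  qed
qed

lemma reads_transport:
  assumes X: "reads r X f" and h: "\<And>b. b \<in> carrier X \<Longrightarrow> k (h b) = b"
    and g: "\<And>b. b \<in> carrier X \<Longrightarrow> g (h b) = f b"
  shows "reads r (transport h k X) g"
proof -
  have comp: "map_option g (map_option h x) = map_option f x" if "set_option x \<subseteq> carrier X" for x
    using that g by (cases x) auto
  have "\<exists>n. \<forall>b\<in>carrier X. length (f b) = n" using X by (simp add: reads_def)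
  moreover have "inj_on g (h ` carrier X)"
    using X h g unfolding reads_def inj_on_def by (metis imageE)
  moreover have "set_option (map_option h x) \<subseteq> h ` carrier X" if "set_option x \<subseteq> carrier X" for x
    using that by (cases x) auto
  ultimately show ?thesis
    using X unfolding reads_def transport_def
    by (auto simp: h g comp simp del: option.set_map)
qed

lemma reads_tensor_list:
  assumes "\<And>X. X \<in> set Xs \<Longrightarrow> reads r X (\<lambda>C. C)"
  shows "reads r (tensor_list Xs) concat"
  using assms
proof (induction Xs)
  case Nil
  show ?case by (auto simp: reads_def word_wt_def)
next
  case (Cons X Xs)
  have "reads r (tensor X (tensor_list Xs)) (\<lambda>(b, c). b @ concat c)"
    by (rule reads_tensor) (use Cons in auto)
  then show ?case unfolding tensor_list.simps by (rule reads_transport) auto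
qed

lemma component_refl: "b \<in> component r X b"
  by (simp add: component_def)

lemma component_sym: "c \<in> component r X b \<Longrightarrow> b \<in> component r X c"
proof -
  have "sym ((crystal_graph r X \<union> (crystal_graph r X)\<inverse>)\<^sup>*)"
    by (rule sym_rtrancl) (auto simp: sym_def)
  then show "c \<in> component r X b \<Longrightarrow> b \<in> component r X c"
    unfolding component_def by (auto dest: symD)
qed

lemma component_trans: "c \<in> component r X b \<Longrightarrow> d \<in> component r X c \<Longrightarrow> d \<in> component r X b"
  unfolding component_def by auto

lemma component_F: "b \<in> carrier X \<Longrightarrow> c \<in> carrier X \<Longrightarrow> i \<in> {1..r} \<Longrightarrow> Fop X i b = Some c \<Longrightarrow> c \<in> component r X b"
  unfolding component_def crystal_graph_def by (auto intro!: r_into_rtrancl)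

lemma component_induct [consumes 1, case_names base F E]:
  assumes "c \<in> component r X b" and "P b"
    and F: "\<And>c d i. \<lbrakk>c \<in> component r X b; P c; i \<in> {1..r}; c \<in> carrier X; d \<in> carrier X; Fop X i c = Some d\<rbrakk> \<Longrightarrow> P d"
    and E: "\<And>c d i. \<lbrakk>c \<in> component r X b; P c; i \<in> {1..r}; c \<in> carrier X; d \<in> carrier X; Fop X i d = Some c\<rbrakk> \<Longrightarrow> P d"
  shows "P c"
  using assms(1)[unfolded component_def mem_Collect_eq]
proof (induction rule: rtrancl_induct)
  case base
  show ?case by (rule assms(2))
next
  case (step c d)
  then have "c \<in> component r X b" unfolding component_def by simp
  then show ?case using step F E unfolding crystal_graph_def by blast
qed

lemma component_carrier: "b \<in> carrier X \<Longrightarrow> component r X b \<subseteq> carrier X"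
proof
  show "c \<in> carrier X" if "b \<in> carrier X" "c \<in> component r X b" for c
    using that(2,1) by (induction rule: component_induct) auto
qed

lemma reads_component:
  assumes X: "reads r X f" and u: "u \<in> carrier X"
  shows "reads r (X\<lparr>carrier := component r X u\<rparr>) f"
proof (rule reads_subcrystal[OF X component_carrier[OF u]])
  fix i b c assume i: "i \<in> {1..r}" and b: "b \<in> component r X u" and c: "c \<in> carrier X"
  have b': "b \<in> carrier X" using b component_carrier[OF u] by auto
  show "c \<in> component r X u" if "Fop X i b = Some c"
    using component_trans[OF b component_F[OF b' c i that]] .
  show "c \<in> component r X u" if "Eop X i b = Some c"
    using component_trans[OF b component_sym[OF component_F[OF c b' i]]] that
    by (simp add: reads_E_iff_F[OF X i b' c])
qed

text \<open>Every path from \<open>u\<close> stays in the component, so restricting the carrier to it loses no edge.\<close>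

lemma component_idem:
  assumes u: "u \<in> carrier X"
  shows "component r (X\<lparr>carrier := component r X u\<rparr>) u = component r X u"
proof
  have "u \<in> carrier (X\<lparr>carrier := component r X u\<rparr>)" by (simp add: component_refl)
  from component_carrier[OF this] show "component r (X\<lparr>carrier := component r X u\<rparr>) u \<subseteq> component r X u" by simp
  show "component r X u \<subseteq> component r (X\<lparr>carrier := component r X u\<rparr>) u"
  proof
    fix c assume "c \<in> component r X u"
    then show "c \<in> component r (X\<lparr>carrier := component r X u\<rparr>) u"
    proof (induction rule: component_induct)
      case base
      show ?case by (rule component_refl)
    next
      case (F c d i)
      have "d \<in> component r X u" using component_trans[OF F(1) component_F[OF F(3,4,2,5)]] .
      then have "d \<in> component r (X\<lparr>carrier := component r X u\<rparr>) c"
        using F by (intro component_F[of _ _ _ i]) auto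
      then show ?case by (rule component_trans[OF F.IH])
    next
      case (E c d i)
      have "d \<in> component r X u"
        using component_trans[OF E(1) component_sym[OF component_F[OF E(4,3,2,5)]]] .
      then have "c \<in> component r (X\<lparr>carrier := component r X u\<rparr>) d"
        using E by (intro component_F[of _ _ _ i]) auto
      then show ?case by (rule component_trans[OF E.IH component_sym])
    qed
  qed
qed

lemma knuth_E:
  assumes "u \<approx> v" "word_E i u = Some u'"
  obtains v' where "word_E i v = Some v'" "u' \<approx> v'"
  using knuth_crystal_sim[OF assms(1), of i] assms(2) unfolding crystal_sim_def by (auto simp: option_rel_Some1)

lemma knuth_F:
  assumes "u \<approx> v" "word_F i u = Some u'"
  obtains v' where "word_F i v = Some v'" "u' \<approx> v'"
  using knuth_crystal_sim[OF assms(1), of i] assms(2) unfolding crystal_sim_def by (auto simp: option_rel_Some1)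

lemma reads_knuth_E:
  assumes X: "reads r X f" and Y: "reads r Y g" and i: "i \<in> {1..r}"
    and "b \<in> carrier X" "c \<in> carrier Y" "f b \<approx> g c" "Eop X i b = Some b'"
  obtains c' where "c' \<in> carrier Y" "Eop Y i c = Some c'" "f b' \<approx> g c'"
proof -
  have "word_E i (f b) = Some (f b')" using assms reads_E_Some[OF X i] by blast
  then obtain v where v: "word_E i (g c) = Some v" "f b' \<approx> v" using knuth_E assms(6) by blast
  then obtain c' where c': "Eop Y i c = Some c'" "g c' = v"
    using reads_E_map[OF Y i assms(5)] by (auto simp: map_option_eq_Some)
  then have "c' \<in> carrier Y" using reads_E_Some[OF Y i assms(5)] by blast
  then show ?thesis using that c' v by blast
qed

lemma reads_knuth_F:
  assumes X: "reads r X f" and Y: "reads r Y g" and i: "i \<in> {1..r}"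
    and "b \<in> carrier X" "c \<in> carrier Y" "f b \<approx> g c" "Fop X i b = Some b'"
  obtains c' where "c' \<in> carrier Y" "Fop Y i c = Some c'" "f b' \<approx> g c'"
proof -
  have "word_F i (f b) = Some (f b')" using assms reads_F_Some[OF X i] by blast
  then obtain v where v: "word_F i (g c) = Some v" "f b' \<approx> v" using knuth_F assms(6) by blast
  then obtain c' where c': "Fop Y i c = Some c'" "g c' = v"
    using reads_F_map[OF Y i assms(5)] by (auto simp: map_option_eq_Some)
  then have "c' \<in> carrier Y" using reads_F_Some[OF Y i assms(5)] by blast
  then show ?thesis using that c' v by blast
qed

text \<open>
  A path that starts at \<open>b\<close> can be followed step by step from an equivalent \<open>c\<close>, because
  Knuth equivalence is a bisimulation.
\<close>

lemma component_transfer: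
  assumes X: "reads r X f" and Y: "reads r Y g"
    and "c \<in> carrier Y" "f b \<approx> g c" "b' \<in> component r X b"
  obtains c' where "c' \<in> component r Y c" "f b' \<approx> g c'"
proof -
  have "\<exists>c'\<in>component r Y c. f b' \<approx> g c'"
    using assms(5)
  proof (induction rule: component_induct)
    case base
    show ?case using assms(4) component_refl[of c r Y] by blast
  next
    case (F b1 b2 i)
    then obtain c1 where c1: "c1 \<in> component r Y c" "f b1 \<approx> g c1" by blast
    then have c1': "c1 \<in> carrier Y" using component_carrier[OF assms(3)] by auto
    obtain c2 where c2: "c2 \<in> carrier Y" "Fop Y i c1 = Some c2" "f b2 \<approx> g c2"
      using reads_knuth_F[OF X Y F(2,3) c1' c1(2) F(5)] .
    have "c2 \<in> component r Y c"
      by (rule component_trans[OF c1(1) component_F[OF c1' c2(1) F(2) c2(2)]])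
    then show ?case using c2 by blast
  next
    case (E b1 b2 i)
    then obtain c1 where c1: "c1 \<in> component r Y c" "f b1 \<approx> g c1" by blast
    then have c1': "c1 \<in> carrier Y" using component_carrier[OF assms(3)] by auto
    have "Eop X i b1 = Some b2" using E reads_E_iff_F[OF X] by blast
    then obtain c2 where c2: "c2 \<in> carrier Y" "Eop Y i c1 = Some c2" "f b2 \<approx> g c2"
      using reads_knuth_E[OF X Y E(2,3) c1' c1(2)] by blast
    then have "Fop Y i c2 = Some c1" using E(2) c1' reads_E_iff_F[OF Y] by blast
    then have "c2 \<in> component r Y c"
      using component_trans[OF c1(1) component_sym[OF component_F[OF c2(1) c1' E(2)]]] by simp
    then show ?case using c2 by blast
  qed
  then show ?thesis using that by blast
qed

text \<open>
  If the base point \<open>u\<close> has at most one partner in \<open>Y\<close>, so has every element of its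
  component: walking back to \<open>u\<close> takes any two partners of \<open>b\<close> to the same element, and the
  operators are partially injective.
\<close>

lemma component_transfer_unique:
  assumes X: "reads r X f" and Y: "reads r Y g"
    and u: "\<And>c c'. c \<in> carrier Y \<Longrightarrow> c' \<in> carrier Y \<Longrightarrow> f u \<approx> g c \<Longrightarrow> f u \<approx> g c' \<Longrightarrow> c = c'"
    and "b \<in> component r X u"
    and "c \<in> carrier Y" "c' \<in> carrier Y" "f b \<approx> g c" "f b \<approx> g c'"
  shows "c = c'"
  using assms(4-)
proof (induction arbitrary: c c' rule: component_induct)
  case base
  then show ?case using u by blast
next
  case (F b1 b2 i)
  have *: "\<exists>d. d \<in> carrier Y \<and> f b1 \<approx> g d \<and> Fop Y i d = Some c" if h: "c \<in> carrier Y" "f b2 \<approx> g c" for c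
  proof -
    have "Eop X i b2 = Some b1" using F reads_E_iff_F[OF X] by blast
    then obtain d where "d \<in> carrier Y" "Eop Y i c = Some d" "f b1 \<approx> g d"
      using reads_knuth_E[OF X Y F(2,4) h] by blast
    then show ?thesis using F(2) h reads_E_iff_F[OF Y] by blast
  qed
  obtain d d' where "d \<in> carrier Y" "f b1 \<approx> g d" "Fop Y i d = Some c"
    "d' \<in> carrier Y" "f b1 \<approx> g d'" "Fop Y i d' = Some c'"
    using *[OF F.prems(1,3)] *[OF F.prems(2,4)] by blast
  moreover from this have "d = d'" using F.IH by blast
  ultimately show ?case by simp
next
  case (E b1 b2 i)
  have *: "\<exists>d. d \<in> carrier Y \<and> f b1 \<approx> g d \<and> Eop Y i d = Some c" if h: "c \<in> carrier Y" "f b2 \<approx> g c" for c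
  proof -
    obtain d where "d \<in> carrier Y" "Fop Y i c = Some d" "f b1 \<approx> g d"
      using reads_knuth_F[OF X Y E(2,4) h E(5)] by blast
    then show ?thesis using E(2) h reads_E_iff_F[OF Y] by blast
  qed
  obtain d d' where "d \<in> carrier Y" "f b1 \<approx> g d" "Eop Y i d = Some c"
    "d' \<in> carrier Y" "f b1 \<approx> g d'" "Eop Y i d' = Some c'"
    using *[OF E.prems(1,3)] *[OF E.prems(2,4)] by blast
  moreover from this have "d = d'" using E.IH by blast
  ultimately show ?case by simp
qed

section \<open>Tensor products of columns\<close>

text \<open>
  A column contains $i$ and $i+1$ at most once each, in this order; if both occur they cancel. So
  the column crystal is a part of the crystal of words.
\<close>

lemma column_ops:
  assumes "sorted_wrt (<) C"
  shows "word_eps i C = of_bool (Suc i \<in> set C \<and> i \<notin> set C)"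
    and "word_phi i C = of_bool (i \<in> set C \<and> Suc i \<notin> set C)"
    and "word_E i C = (if Suc i \<in> set C \<and> i \<notin> set C
           then Some (map (\<lambda>x. if x = Suc i then i else x) C) else None)"
    and "word_F i C = (if i \<in> set C \<and> Suc i \<notin> set C
           then Some (map (\<lambda>x. if x = i then Suc i else x) C) else None)"
proof -
  have "word_eps i C = of_bool (Suc i \<in> set C \<and> i \<notin> set C) \<and>
    word_phi i C = of_bool (i \<in> set C \<and> Suc i \<notin> set C) \<and>
    word_E i C = (if Suc i \<in> set C \<and> i \<notin> set C
           then Some (map (\<lambda>x. if x = Suc i then i else x) C) else None) \<and>
    word_F i C = (if i \<in> set C \<and> Suc i \<notin> set C
           then Some (map (\<lambda>x. if x = i then Suc i else x) C) else None)"
    using assms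
  proof (induction C)
    case (Cons x C)
    consider "x = i" | "x = Suc i" | "x \<noteq> i" "x \<noteq> Suc i" by blast
    then show ?case
    proof cases
      case 1
      then have "i \<notin> set C" using Cons.prems by auto
      then show ?thesis using 1 Cons
        by (auto intro!: map_idI[symmetric])
    next
      case 2
      then have "i \<notin> set C" "Suc i \<notin> set C" using Cons.prems by auto
      then show ?thesis using 2 Cons by (auto intro!: map_idI[symmetric])
    next
      case 3
      then show ?thesis using Cons by auto
    qed
  qed simp
  then show "word_eps i C = of_bool (Suc i \<in> set C \<and> i \<notin> set C)"
    "word_phi i C = of_bool (i \<in> set C \<and> Suc i \<notin> set C)"
    "word_E i C = (if Suc i \<in> set C \<and> i \<notin> set C
           then Some (map (\<lambda>x. if x = Suc i then i else x) C) else None)"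
    "word_F i C = (if i \<in> set C \<and> Suc i \<notin> set C
           then Some (map (\<lambda>x. if x = i then Suc i else x) C) else None)"
    by blast+
qed

lemma reads_column_crystal: "reads r (column_crystal r k) (\<lambda>C. C)"
proof -
  have "wt (column_crystal r k) C = word_wt r C" if "sorted_wrt (<) C" for C
  proof -
    have "count (mset C) j = of_bool (j \<in> set C)" for j
      using distinct_count_atmost_1[of C] that[unfolded strict_sorted_iff] by simp
    then show ?thesis by (auto simp: column_crystal_def word_wt_def)
  qed
  moreover have "sorted_wrt (<) (map (\<lambda>x. if x = Suc i then i else x) C)"
    if "sorted_wrt (<) C" "i \<notin> set C" for i and C :: column
    unfolding sorted_wrt_map
    by (rule sorted_wrt_mono_rel[OF _ that(1)])
      (use that(2) in \<open>auto simp: less_Suc_eq\<close>)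
  moreover have "sorted_wrt (<) (map (\<lambda>x. if x = i then Suc i else x) C)"
    if "sorted_wrt (<) C" "Suc i \<notin> set C" for i and C :: column
    unfolding sorted_wrt_map
    by (rule sorted_wrt_mono_rel[OF _ that(1)])
      (use that(2) in \<open>auto intro: Suc_lessI\<close>)
  ultimately show ?thesis
    unfolding reads_def
    by (auto simp: column_crystal_def column_ops subset_eq)
qed

abbreviation column_tensor :: "nat \<Rightarrow> nat list \<Rightarrow> column list crystal" where
  "column_tensor r ks \<equiv> tensor_list (map (column_crystal r) ks)"

lemma reads_column_tensor: "reads r (column_tensor r ks) concat"
  by (rule reads_tensor_list) (auto simp: reads_column_crystal)

lemma carrier_column_crystal:
  "carrier (column_crystal r k) = {C. length C = k \<and> sorted_wrt (<) C \<and> set C \<subseteq> {1..Suc r}}"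
  by (simp add: column_crystal_def)

lemma carrier_column_tensor:
  "b \<in> carrier (column_tensor r ks) \<longleftrightarrow>
     map length b = ks \<and> (\<forall>C\<in>set b. sorted_wrt (<) C \<and> set C \<subseteq> {1..Suc r})"
proof (induction ks arbitrary: b)
  case Nil
  then show ?case by auto
next
  case (Cons k ks)
  show ?case
    by (cases b) (auto simp: transport_def tensor_def carrier_column_crystal Cons image_iff)
qed

lemma hw_columns_carrier:
  "set ks \<subseteq> {1..r} \<Longrightarrow> map hw_column ks \<in> carrier (column_tensor r ks)"
  unfolding carrier_column_tensor by (auto simp: comp_def simp del: upt_Suc intro!: map_idI)

lemma strict_column_nth:
  assumes "sorted_wrt (<) C" "set C \<subseteq> {1::nat..}" "i < length C"
  shows "Suc i \<le> C ! i"
  using assms(3)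
proof (induction i)
  case 0
  then show ?case using assms(2) nth_mem[of 0 C] by force
next
  case (Suc i)
  have "C ! i < C ! Suc i" using assms(1) Suc.prems by (simp add: sorted_wrt_nth_less)
  then show ?case using Suc by simp
qed

lemma sum_list_column:
  assumes "sorted_wrt (<) C" "set C \<subseteq> {1::nat..}"
  shows "sum_list (hw_column (length C)) \<le> sum_list C"
    and "sum_list C \<le> sum_list (hw_column (length C)) \<Longrightarrow> C = hw_column (length C)"
proof -
  have hw: "sum_list (hw_column (length C)) = (\<Sum>i<length C. Suc i)"
    by (simp add: sum_list_sum_nth lessThan_atLeast0 del: upt_Suc)
  have C: "sum_list C = (\<Sum>i<length C. C ! i)"
    by (simp add: sum_list_sum_nth lessThan_atLeast0)
  show "sum_list (hw_column (length C)) \<le> sum_list C"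
    unfolding hw C by (rule sum_mono) (use strict_column_nth[OF assms] in simp)
  assume le: "sum_list C \<le> sum_list (hw_column (length C))"
  have "C ! i = Suc i" if "i < length C" for i
  proof (rule ccontr)
    assume "C ! i \<noteq> Suc i"
    then have "Suc i < C ! i" using strict_column_nth[OF assms that] by simp
    then have "(\<Sum>i<length C. Suc i) < (\<Sum>i<length C. C ! i)"
      using strict_column_nth[OF assms] that by (intro sum_strict_mono_ex1) auto
    then show False using le unfolding hw C by simp
  qed
  then show "C = hw_column (length C)"
    by (intro nth_equalityI) (simp_all del: upt_Suc)
qed

text \<open>
  Among the columns of a given length $(1,\dots,k)$ has the least sum of entries, so the sum alone
  recognizes the highest weight element.
\<close>

lemma hw_columns_unique:
  assumes "b \<in> carrier (column_tensor r ks)" "sum_list (concat b) \<le> sum_list (hw_word ks)"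
  shows "b = map hw_column ks"
proof -
  have "sum_list (hw_word ks) \<le> sum_list (concat b) \<and>
      (sum_list (concat b) \<le> sum_list (hw_word ks) \<longrightarrow> b = map hw_column ks)"
    using assms(1) unfolding carrier_column_tensor
  proof (induction b arbitrary: ks)
    case (Cons C b)
    then have C: "sorted_wrt (<) C" "set C \<subseteq> {1..}" and ks: "ks = length C # map length b"
      by auto
    have IH: "sum_list (hw_word (map length b)) \<le> sum_list (concat b) \<and>
        (sum_list (concat b) \<le> sum_list (hw_word (map length b)) \<longrightarrow>
          b = map hw_column (map length b))"
      by (rule Cons.IH) (use Cons.prems in simp)
    have hw: "sum_list (hw_word ks) =
        sum_list (hw_column (length C)) + sum_list (hw_word (map length b))"
      unfolding ks by (simp del: upt_Suc)
    show ?case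
    proof (intro conjI impI)
      show "sum_list (hw_word ks) \<le> sum_list (concat (C # b))"
        using sum_list_column(1)[OF C] conjunct1[OF IH] unfolding hw by simp
      assume "sum_list (concat (C # b)) \<le> sum_list (hw_word ks)"
      then have "sum_list C \<le> sum_list (hw_column (length C))"
        "sum_list (concat b) \<le> sum_list (hw_word (map length b))"
        using sum_list_column(1)[OF C] conjunct1[OF IH] unfolding hw by simp_all
      then have "C = hw_column (length C)" "b = map hw_column (map length b)"
        using sum_list_column(2)[OF C] conjunct2[OF IH] by blast+
      then show "C # b = map hw_column ks"
        unfolding ks list.map by (rule arg_cong2[where f = Cons])
    qed
  next
    case Nil
    then have "ks = []" by (metis list.map(1))
    then show ?case by simp
  qed
  then show ?thesis using assms(2) by blast
qed

lemma hw_columns_knuth_unique: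
  assumes "b \<in> carrier (column_tensor r ks')" "hw_word ks \<approx> concat b" "mset ks = mset ks'"
  shows "b = map hw_column ks'"
proof -
  have "hw_word ks' \<approx> concat b"
    using hw_words_permute[OF assms(3)[symmetric]] assms(2) by (rule knuth_trans)
  then have "sum_list (concat b) = sum_list (hw_word ks')"
    by (metis knuth_mset sum_mset_sum_list)
  then show ?thesis using hw_columns_unique[OF assms(1)] by simp
qed

context
  fixes r :: nat and ks ks' :: "nat list"
  assumes ks: "set ks \<subseteq> {1..r}" and perm: "mset ks = mset ks'"
begin

text \<open>
  Together with the next lemma: Knuth equivalence matches the Cartan components for two orders of
  the same column lengths bijectively.
\<close>

lemma cartan_transfer:
  assumes "b \<in> component r (column_tensor r ks) (map hw_column ks)"
  obtains c where "c \<in> component r (column_tensor r ks') (map hw_column ks')" "concat b \<approx> concat c"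
proof (rule component_transfer[OF reads_column_tensor reads_column_tensor _ _ assms])
  show "map hw_column ks' \<in> carrier (column_tensor r ks')"
    using ks mset_eq_setD[OF perm] by (intro hw_columns_carrier) simp
  show "hw_word ks \<approx> hw_word ks'" by (rule hw_words_permute[OF perm])
qed (rule that)

lemma cartan_knuth_unique:
  assumes "b \<in> component r (column_tensor r ks) (map hw_column ks)"
    and "c \<in> carrier (column_tensor r ks')" "c' \<in> carrier (column_tensor r ks')"
    and "concat b \<approx> concat c" "concat b \<approx> concat c'"
  shows "c = c'"
proof (rule component_transfer_unique[OF reads_column_tensor reads_column_tensor _ assms])
  show "d = d'" if "d \<in> carrier (column_tensor r ks')" "d' \<in> carrier (column_tensor r ks')"
      "hw_word ks \<approx> concat d" "hw_word ks \<approx> concat d'" for d d'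
    using hw_columns_knuth_unique[OF that(1,3) perm] hw_columns_knuth_unique[OF that(2,4) perm] by simp
qed

end

text \<open>
  Pairing the weight with the sum of the positive coroots
  $\sum_{j=1}^{r} j (r + 1 - j) \alpha_j^\vee$, under which the letter $x$ has value
  $r + 2 - 2x$. For words of fixed length the weight therefore determines the sum of the letters.
\<close>

lemma word_wt_sum_list:
  assumes "set w \<subseteq> {1..Suc r}"
  shows "(\<Sum>j=1..r. int j * (int r + 1 - int j) * word_wt r w j)
           = (int r + 2) * int (length w) - 2 * int (sum_list w)"
  using assms
proof (induction w)
  case Nil
  then show ?case by (simp add: word_wt_def)
next
  case (Cons x w)
  let ?a = "\<lambda>j. int j * (int r + 1 - int j)"
  have x: "1 \<le> x" "x \<le> Suc r" using Cons.prems by auto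
  have "(\<Sum>j=1..r. ?a j * word_wt r (x # w) j)
      = (\<Sum>j=1..r. ?a j * word_wt r w j) + ((\<Sum>j=1..r. if x = j then ?a j else 0) -
          (\<Sum>j=1..r. if x - 1 = j then ?a j else 0))"
    unfolding sum.distrib[symmetric] sum_subtractf[symmetric]
    by (rule sum.cong) (use x in \<open>auto simp: word_wt_def algebra_simps\<close>)
  also have "(\<Sum>j=1..r. if x = j then ?a j else 0) = ?a x"
    using x by (auto simp: sum.delta' le_Suc_eq)
  also have "(\<Sum>j=1..r. if x - 1 = j then ?a j else 0) = ?a (x - 1)"
    using x by (auto simp: sum.delta' le_Suc_eq)
  also have "?a x - ?a (x - 1) = int r + 2 - 2 * int x"
    using x by (simp add: of_nat_diff algebra_simps)
  finally show ?case using Cons by (simp add: algebra_simps)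
qed

lemma word_wt_eq_sum_list:
  assumes "set v \<subseteq> {1..Suc r}" "set w \<subseteq> {1..Suc r}" "length v = length w" "word_wt r v = word_wt r w"
  shows "sum_list v = sum_list w"
  using word_wt_sum_list[OF assms(1), unfolded assms(3,4)] word_wt_sum_list[OF assms(2)] by linarith

lemma word_wt_cong: "mset v = mset w \<Longrightarrow> word_wt r v = word_wt r w"
  by (simp only: word_wt_def)

section \<open>Right ends\<close>

text \<open>
  Knuth equivalence defines an embedding of a connected crystal onto a component of \<open>Y\<close>. It is the
  only embedding, since the weight determines the image of \<open>u\<close> and the operators determine the
  rest. So the definite description returns it.
\<close>

lemma the_embedding_knuth:
  assumes X: "reads r X f" and Y: "reads r Y g"
    and u: "u \<in> carrier X" and conn: "carrier X = component r X u"
    and v: "v \<in> carrier Y" and uv: "f u \<approx> g v"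
    and uX: "\<And>b. b \<in> carrier X \<Longrightarrow> wt X b = wt X u \<Longrightarrow> b = u"
    and vY: "\<And>c. c \<in> carrier Y \<Longrightarrow> wt Y c = wt X u \<Longrightarrow> c = v"
  defines "\<phi> \<equiv> THE \<psi>. crystal_embedding r X Y \<psi> \<and> (\<exists>y\<in>carrier Y. \<psi> ` carrier X = component r Y y)"
  assumes b: "b \<in> carrier X"
  shows "\<phi> b \<in> carrier Y" "f b \<approx> g (\<phi> b)"
proof -
  have wt: "wt Y c = wt X b" if "b \<in> carrier X" "c \<in> carrier Y" "f b \<approx> g c" for b c
    using that reads_wt[OF X] reads_wt[OF Y] word_wt_cong[OF knuth_mset] by metis
  have ex: "\<exists>c. c \<in> carrier Y \<and> c \<in> component r Y v \<and> f b \<approx> g c" if h: "b \<in> carrier X" for b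
  proof -
    obtain c where "c \<in> component r Y v" "f b \<approx> g c"
      using component_transfer[OF X Y v uv] h conn by blast
    then show ?thesis using component_carrier[OF v] by blast
  qed
  have uni: "c = c'"
    if "b \<in> carrier X" "c \<in> carrier Y" "c' \<in> carrier Y" "f b \<approx> g c" "f b \<approx> g c'" for b c c'
  proof (rule component_transfer_unique[OF X Y _ _ that(2-)])
    show "b \<in> component r X u" using that(1) conn by simp
    show "d = d'" if "d \<in> carrier Y" "d' \<in> carrier Y" "f u \<approx> g d" "f u \<approx> g d'" for d d'
      using vY[OF that(1)] vY[OF that(2)] wt[OF u that(1,3)] wt[OF u that(2,4)] by simp
  qed
  have uni': "b = b'"
    if "c \<in> component r Y v" "b \<in> carrier X" "b' \<in> carrier X" "f b \<approx> g c" "f b' \<approx> g c" for b b' c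
  proof (rule component_transfer_unique[OF Y X _ that(1-3)])
    show "g c \<approx> f b" "g c \<approx> f b'" by (rule knuth_sym[OF that(4)], rule knuth_sym[OF that(5)])
    show "d = d'" if "d \<in> carrier X" "d' \<in> carrier X" "g v \<approx> f d" "g v \<approx> f d'" for d d'
      using uX[OF that(1)] uX[OF that(2)] wt[OF u v uv] wt[OF that(1) v knuth_sym[OF that(3)]]
        wt[OF that(2) v knuth_sym[OF that(4)]] by simp
  qed
  define \<psi> where "\<psi> = restrict (\<lambda>b. SOME c. c \<in> carrier Y \<and> c \<in> component r Y v \<and> f b \<approx> g c) (carrier X)"
  have \<psi>: "\<psi> b \<in> carrier Y \<and> \<psi> b \<in> component r Y v \<and> f b \<approx> g (\<psi> b)" if "b \<in> carrier X" for b
    using someI_ex[OF ex[OF that]] that unfolding \<psi>_def by simp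
  have \<psi>I: "\<psi> b = c" if "b \<in> carrier X" "c \<in> carrier Y" "f b \<approx> g c" for b c
    using uni[OF that(1) _ that(2) _ that(3)] \<psi>[OF that(1)] by blast
  have emb: "crystal_embedding r X Y \<psi>"
    unfolding crystal_embedding_def
  proof (intro conjI ballI)
    show "\<psi> \<in> carrier X \<rightarrow>\<^sub>E carrier Y" using \<psi> unfolding \<psi>_def by auto
    show "inj_on \<psi> (carrier X)"
      by (rule inj_onI) (metis \<psi> uni')
    fix b assume b: "b \<in> carrier X"
    show "wt Y (\<psi> b) = wt X b" using wt \<psi> b by blast
    fix i assume i: "i \<in> {1..r}"
    have pb: "\<psi> b \<in> carrier Y" "f b \<approx> g (\<psi> b)" "g (\<psi> b) \<approx> f b"
      using \<psi>[OF b] knuth_sym by blast+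
    show "Eop Y i (\<psi> b) = map_option \<psi> (Eop X i b)"
    proof (cases "Eop X i b")
      case None
      show ?thesis
      proof (cases "Eop Y i (\<psi> b)")
        case (Some c)
        then obtain b' where "Eop X i b = Some b'"
          using reads_knuth_E[OF Y X i pb(1) b pb(3)] by blast
        then show ?thesis using None by simp
      qed (simp add: None)
    next
      case (Some b')
      then obtain c where c: "c \<in> carrier Y" "Eop Y i (\<psi> b) = Some c" "f b' \<approx> g c"
        using reads_knuth_E[OF X Y i b pb(1,2)] by blast
      have "b' \<in> carrier X" using Some reads_E_Some[OF X i b] by blast
      then have "\<psi> b' = c" by (rule \<psi>I[OF _ c(1,3)])
      then show ?thesis using Some c(2) by simp
    qed
    show "Fop Y i (\<psi> b) = map_option \<psi> (Fop X i b)"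
    proof (cases "Fop X i b")
      case None
      show ?thesis
      proof (cases "Fop Y i (\<psi> b)")
        case (Some c)
        then obtain b' where "Fop X i b = Some b'"
          using reads_knuth_F[OF Y X i pb(1) b pb(3)] by blast
        then show ?thesis using None by simp
      qed (simp add: None)
    next
      case (Some b')
      then obtain c where c: "c \<in> carrier Y" "Fop Y i (\<psi> b) = Some c" "f b' \<approx> g c"
        using reads_knuth_F[OF X Y i b pb(1,2)] by blast
      have "b' \<in> carrier X" using Some reads_F_Some[OF X i b] by blast
      then have "\<psi> b' = c" by (rule \<psi>I[OF _ c(1,3)])
      then show ?thesis using Some c(2) by simp
    qed
  qed
  have "\<psi> ` carrier X = component r Y v"
  proof
    show "\<psi> ` carrier X \<subseteq> component r Y v" using \<psi> by blast
    show "component r Y v \<subseteq> \<psi> ` carrier X"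
    proof
      fix c assume c: "c \<in> component r Y v"
      obtain b where b: "b \<in> component r X u" "g c \<approx> f b"
        using component_transfer[OF Y X u knuth_sym[OF uv] c] .
      have "b \<in> carrier X" "c \<in> carrier Y" using b(1) conn c component_carrier[OF v] by auto
      then have "\<psi> b = c" "b \<in> carrier X" using \<psi>I knuth_sym[OF b(2)] by simp_all
      then show "c \<in> \<psi> ` carrier X" by blast
    qed
  qed
  then have img: "\<exists>y\<in>carrier Y. \<psi> ` carrier X = component r Y y" using v by blast
  have op: "Eop Y i (\<theta> b) = map_option \<theta> (Eop X i b)" "Fop Y i (\<theta> b) = map_option \<theta> (Fop X i b)"
    if "crystal_embedding r X Y \<theta>" "b \<in> carrier X" "i \<in> {1..r}" for \<theta> b i
    using that unfolding crystal_embedding_def by blast+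
  have "\<theta> = \<psi>" if \<theta>: "crystal_embedding r X Y \<theta>" for \<theta>
  proof
    fix b
    show "\<theta> b = \<psi> b"
    proof (cases "b \<in> carrier X")
      case False
      then show ?thesis using \<theta> emb unfolding crystal_embedding_def by (auto dest!: PiE_arb)
    next
      case True
      then have "b \<in> component r X u" using conn by simp
      then show ?thesis
      proof (induction rule: component_induct)
        case base
        have "\<theta> u \<in> carrier Y" "wt Y (\<theta> u) = wt X u"
          using \<theta> u unfolding crystal_embedding_def by auto
        then show ?case using vY \<psi>I[OF u v uv] by blast
      next
        case (F c d i)
        have "Fop Y i (\<theta> c) = Some (\<theta> d)" "Fop Y i (\<psi> c) = Some (\<psi> d)"
          using op(2)[OF \<theta> F(3,2)] op(2)[OF emb F(3,2)] F(5) by simp_all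
        then show ?case using F by simp
      next
        case (E c d i)
        then have "Eop X i c = Some d" using reads_E_iff_F[OF X] by blast
        then have "Eop Y i (\<theta> c) = Some (\<theta> d)" "Eop Y i (\<psi> c) = Some (\<psi> d)"
          using op(1)[OF \<theta> E(3,2)] op(1)[OF emb E(3,2)] by simp_all
        then show ?case using E by simp
      qed
    qed
  qed
  then have "\<phi> = \<psi>" unfolding \<phi>_def using emb img by (intro the_equality) blast+
  then show "\<phi> b \<in> carrier Y" "f b \<approx> g (\<phi> b)" using \<psi>[OF b] by simp_all
qed

lemma sum_fund: "(\<Sum>i\<leftarrow>ks. fund i j) = int (count (mset ks) j)"
  by (induction ks) (auto simp: fund_def)

text \<open>Both sides are sorted lists with the same multiplicities.\<close>

lemma fund_indices_sum:
  assumes "sorted ks" "set ks \<subseteq> {1..r}"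
  shows "fund_indices r (\<lambda>j. \<Sum>i\<leftarrow>ks. fund i j) = ks"
proof -
  \<comment> \<open>The list in the definition, truncated at \<open>n\<close> so that induction applies.\<close>
  let ?c = "\<lambda>n. concat (map (\<lambda>i. replicate (count (mset ks) i) i) [1..<Suc n])"
  have c: "sorted (?c n) \<and> set (?c n) \<subseteq> {..n} \<and>
      (\<forall>j. count (mset (?c n)) j = (if j \<in> {1..n} then count (mset ks) j else 0))" for n
  proof (induction n)
    case (Suc n)
    then show ?case by (auto simp: sorted_append le_Suc_eq)
  qed simp
  have "mset (?c r) = mset ks"
  proof (rule multiset_eqI)
    show "count (mset (?c r)) j = count (mset ks) j" for j
      using c[of r] assms(2) by (cases "j \<in> set ks") (auto simp: count_eq_zero_iff not_in_iff)
  qed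
  then have "?c r = ks"
    using c[of r] assms(1) by (metis properties_for_sort sorted_sort_id)
  then show ?thesis unfolding fund_indices_def sum_fund by simp
qed

lemma hw_crystal_sum:
  assumes "sorted ks" "set ks \<subseteq> {1..r}" "lam = (\<lambda>j. \<Sum>i\<leftarrow>ks. fund i j)"
  shows "hw_crystal r lam = (column_tensor r ks)\<lparr>carrier :=
      component r (column_tensor r ks) (map hw_column ks)\<rparr>"
  unfolding hw_crystal_def assms(3) fund_indices_sum[OF assms(1,2)] Let_def ..

lemma reads_hw_crystal:
  assumes "sorted ks" "set ks \<subseteq> {1..r}" "lam = (\<lambda>j. \<Sum>i\<leftarrow>ks. fund i j)"
  shows "reads r (hw_crystal r lam) concat"
  unfolding hw_crystal_sum[OF assms]
  by (rule reads_component[OF reads_column_tensor hw_columns_carrier[OF assms(2)]])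

text \<open>
  The crystal $\mathcal{B}(\lambda - \omega_i) \otimes \mathcal{B}(\omega_i)$ consists of lists
  \<open>x @ [C]\<close> in the tensor product of the columns in the order \<open>remove1 i ks @ [i]\<close>, so the
  Cartan inclusion is a case of the previous description.
\<close>

lemma right_end_knuth:
  assumes ks: "sorted ks" "set ks \<subseteq> {1..r}" and i: "i \<in> set ks"
    and lam: "lam = (\<lambda>j. \<Sum>i\<leftarrow>ks. fund i j)"
    and b: "b \<in> component r (column_tensor r ks) (map hw_column ks)"
  obtains x C where "right_end r lam (fund i) b = [C]"
    "x @ [C] \<in> carrier (column_tensor r (remove1 i ks @ [i]))"
    "concat b \<approx> concat (x @ [C])"
proof -
  let ?ks = "remove1 i ks"
  have ks': "sorted ?ks" "set ?ks \<subseteq> {1..r}" "mset (?ks @ [i]) = mset ks"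
    using ks i by (auto simp: sorted_remove1 dest: notin_set_remove1)
  have i': "sorted [i]" "set [i] \<subseteq> {1..r}" using ks i by auto
  have lam': "(\<lambda>j. lam j - fund i j) = (\<lambda>j. \<Sum>i\<leftarrow>?ks. fund i j)"
    unfolding lam sum_fund using i by (auto simp: fun_eq_iff fund_def of_nat_diff Suc_leI)
  have fund: "fund i = (\<lambda>j. \<Sum>i\<leftarrow>[i]. fund i j)" by simp
  let ?X = "hw_crystal r lam"
  let ?Y = "tensor (hw_crystal r (\<lambda>j. lam j - fund i j)) (hw_crystal r (fund i))"
  let ?f = "\<lambda>(x, y). concat x @ concat y"
  let ?u = "map hw_column ks" and ?v = "(map hw_column ?ks, map hw_column [i])"
  have X: "reads r ?X concat" by (rule reads_hw_crystal[OF ks lam])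
  have Y: "reads r ?Y ?f"
    by (rule reads_tensor[OF reads_hw_crystal[OF ks'(1,2) lam'] reads_hw_crystal[OF i' fund]])
  have cX: "carrier ?X = component r (column_tensor r ks) ?u"
    unfolding hw_crystal_sum[OF ks lam] by simp
  have cY: "carrier ?Y = component r (column_tensor r ?ks) (map hw_column ?ks) \<times>
      component r (column_tensor r [i]) (map hw_column [i])"
    unfolding tensor_def hw_crystal_sum[OF ks'(1,2) lam'] hw_crystal_sum[OF i' fund] by simp
  have subX: "carrier ?X \<subseteq> carrier (column_tensor r ks)"
    unfolding cX by (rule component_carrier[OF hw_columns_carrier[OF ks(2)]])
  have memY: "x \<in> carrier (column_tensor r ?ks)" "y \<in> carrier (column_tensor r [i])"
    if "(x, y) \<in> carrier ?Y" for x y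
    using that subsetD[OF component_carrier[OF hw_columns_carrier[OF ks'(2)]], of x]
      subsetD[OF component_carrier[OF hw_columns_carrier[OF i'(2)]], of y]
    unfolding cY by blast+
  have len_y: "length y = 1" if "(x, y) \<in> carrier ?Y" for x y
    using arg_cong[OF conjunct1[OF memY(2)[OF that, unfolded carrier_column_tensor]], of length] by simp
  have subY: "x @ y \<in> carrier (column_tensor r (?ks @ [i]))" if "(x, y) \<in> carrier ?Y" for x y
    using memY[OF that] unfolding carrier_column_tensor by (simp add: ball_Un)
  have u: "?u \<in> carrier ?X" unfolding cX by (rule component_refl)
  have v: "?v \<in> carrier ?Y" unfolding cY by (simp add: component_refl del: list.map upt_Suc)
  have uv: "concat ?u \<approx> ?f ?v" using hw_words_permute[OF ks'(3)[symmetric]] by simp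
  have conn: "carrier ?X = component r ?X ?u"
    unfolding cX unfolding hw_crystal_sum[OF ks lam]
    by (rule component_idem[symmetric, OF hw_columns_carrier[OF ks(2)]])
  have len: "length w = sum_list l"
    if "c \<in> carrier (column_tensor r l)" "w = concat c" for c l and w :: "nat list"
    using that unfolding carrier_column_tensor by (auto simp: length_concat)
  have ent: "set (concat c) \<subseteq> {1..Suc r}" if "c \<in> carrier (column_tensor r l)" for c l
    using that unfolding carrier_column_tensor by auto
  note ukr = hw_columns_carrier[OF ks(2)]
  have uX: "c = ?u" if "c \<in> carrier ?X" "wt ?X c = wt ?X ?u" for c
  proof -
    have c: "c \<in> carrier (column_tensor r ks)" using that(1) subX by blast
    have "word_wt r (concat c) = word_wt r (concat ?u)"
      using that(2) reads_wt[OF X that(1)] reads_wt[OF X u] by simp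
    then have "sum_list (concat c) = sum_list (concat ?u)"
      by (rule word_wt_eq_sum_list[OF ent[OF c] ent[OF ukr] trans[OF len[OF c refl] len[OF ukr refl, symmetric]]])
    then show ?thesis using hw_columns_unique[OF c] by simp
  qed
  have vY: "c = ?v" if "c \<in> carrier ?Y" "wt ?Y c = wt ?X ?u" for c
  proof -
    obtain x y where xy: "c = (x, y)" by (cases c)
    have c: "x @ y \<in> carrier (column_tensor r (?ks @ [i]))" using subY that(1) xy by blast
    have vkr: "map hw_column (?ks @ [i]) \<in> carrier (column_tensor r (?ks @ [i]))"
      by (rule hw_columns_carrier) (use ks' i' in auto)
    have "word_wt r (concat (x @ y)) = word_wt r (concat ?u)"
      using that(2) reads_wt[OF Y that(1)] reads_wt[OF X u] xy by simp
    also have "\<dots> = word_wt r (concat (map hw_column (?ks @ [i])))"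
      by (rule word_wt_cong[OF knuth_mset[OF hw_words_permute[OF ks'(3)[symmetric]]]])
    finally have "sum_list (concat (x @ y)) = sum_list (hw_word (?ks @ [i]))"
      by (rule word_wt_eq_sum_list[OF ent[OF c] ent[OF vkr] trans[OF len[OF c refl] len[OF vkr refl, symmetric]]])
    then have *: "x @ y = map hw_column ?ks @ map hw_column [i]"
      using hw_columns_unique[OF c] by simp
    moreover have "length y = length (map hw_column [i])"
      using len_y that(1) unfolding xy by simp
    ultimately show ?thesis unfolding xy by (metis append_eq_append_conv)
  qed
  have bX: "b \<in> carrier ?X" using b cX by simp
  obtain x y where xy: "cartan_inclusion r lam (fund i) b = (x, y)" by fastforce
  have xyY: "(x, y) \<in> carrier ?Y" "concat b \<approx> concat x @ concat y"
    using the_embedding_knuth[OF X Y u conn v uv uX vY bX] xy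
    unfolding cartan_inclusion_def Let_def by simp_all
  obtain C where C: "y = [C]" using len_y[OF xyY(1)] by (auto simp: length_Suc_conv)
  show ?thesis
  proof (rule that[of C x])
    show "right_end r lam (fund i) b = [C]" unfolding right_end_def xy C by simp
    show "x @ [C] \<in> carrier (column_tensor r (?ks @ [i]))" using subY[OF xyY(1)] unfolding C .
    show "concat b \<approx> concat (x @ [C])" using xyY(2) unfolding C by simp
  qed
qed

section \<open>Slides preserve the Knuth class\<close>

text \<open>
  A Young diagram as the function of its column lengths. Two such functions describe each column
  of a skew shape as an interval of rows.
\<close>

definition column_heights :: "cell set \<Rightarrow> (nat \<Rightarrow> nat) \<Rightarrow> bool" where
  "column_heights D h \<longleftrightarrow> (\<forall>i j. (i, j) \<in> D \<longleftrightarrow> i < h j) \<and> antimono h"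

lemma young_diagram_heights:
  assumes "young_diagram D"
  obtains h where "column_heights D h"
proof -
  define h where "h j = (LEAST i. (i, j) \<notin> D)" for j
  have "finite D" and down: "\<And>i j i' j'. (i, j) \<in> D \<Longrightarrow> i' \<le> i \<Longrightarrow> j' \<le> j \<Longrightarrow> (i', j') \<in> D"
    using assms unfolding young_diagram_def by blast+
  have out: "\<exists>i. (i, j) \<notin> D" for j
  proof -
    have "finite ((\<lambda>i. (i, j)) -` D)"
      by (rule finite_vimageI[OF \<open>finite D\<close>]) (auto intro: injI)
    then show ?thesis using infinite_UNIV_nat by (metis UNIV_eq_I vimageI2)
  qed
  have h: "(i, j) \<in> D \<longleftrightarrow> i < h j" for i j
  proof
    show "i < h j" if "(i, j) \<in> D"
      using down[OF that, of "h j" j] LeastI_ex[OF out[of j]] unfolding h_def by fastforce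
    show "(i, j) \<in> D" if "i < h j"
      using not_less_Least that unfolding h_def by blast
  qed
  moreover have "h j' \<le> h j" if "j \<le> j'" for j j'
    using down[of _ j' _ j] that h by (metis leI order.refl less_irrefl)
  ultimately have "column_heights D h" unfolding column_heights_def antimono_def by blast
  then show ?thesis by (rule that)
qed

definition tableau_entries :: "nat \<Rightarrow> filling \<Rightarrow> bool" where
  "tableau_entries r S \<longleftrightarrow> ran S \<subseteq> {1..Suc r} \<and>
     (\<forall>i j j' x y. S (i, j) = Some x \<longrightarrow> S (i, j') = Some y \<longrightarrow> j < j' \<longrightarrow> x \<le> y) \<and>
     (\<forall>i i' j x y. S (i, j) = Some x \<longrightarrow> S (i', j) = Some y \<longrightarrow> i < i' \<longrightarrow> x < y)"

lemma skew_tableau_iff: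
  "skew_tableau r S \<longleftrightarrow> (\<exists>outer inner. skew_shape (dom S) outer inner) \<and> tableau_entries r S"
  unfolding skew_tableau_def tableau_entries_def ..

lemma tableau_entries_row:
  "tableau_entries r S \<Longrightarrow> S (i, j) = Some x \<Longrightarrow> S (i, j') = Some y \<Longrightarrow> j < j' \<Longrightarrow> x \<le> y"
  and tableau_entries_col:
  "tableau_entries r S \<Longrightarrow> S (i, j) = Some x \<Longrightarrow> S (i', j) = Some y \<Longrightarrow> i < i' \<Longrightarrow> x < y"
  unfolding tableau_entries_def by blast+

lemma tableau_entries_move:
  assumes S: "tableau_entries r S" and d: "S d = Some x"
    and "\<And>j' w. j' < j \<Longrightarrow> (i, j') \<noteq> d \<Longrightarrow> S (i, j') = Some w \<Longrightarrow> w \<le> x"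
    and "\<And>j' w. j < j' \<Longrightarrow> (i, j') \<noteq> d \<Longrightarrow> S (i, j') = Some w \<Longrightarrow> x \<le> w"
    and "\<And>i' w. i' < i \<Longrightarrow> (i', j) \<noteq> d \<Longrightarrow> S (i', j) = Some w \<Longrightarrow> w < x"
    and "\<And>i' w. i < i' \<Longrightarrow> (i', j) \<noteq> d \<Longrightarrow> S (i', j) = Some w \<Longrightarrow> x < w"
  shows "tableau_entries r (S((i, j) := Some x, d := None))"
proof -
  let ?S = "S((i, j) := Some x, d := None)"
  have "ran ?S \<subseteq> ran S" using d by (cases d) (auto simp: ran_def split: if_splits)
  then have "ran ?S \<subseteq> {1..Suc r}" using S unfolding tableau_entries_def by blast
  moreover have "v \<le> w" if "?S (a, b) = Some v" "?S (a, b') = Some w" "b < b'" for a b b' v w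
    using that assms(3,4) tableau_entries_row[OF S, of a b v b' w] by (auto split: if_splits)
  moreover have "v < w" if "?S (a, b) = Some v" "?S (a', b) = Some w" "a < a'" for a a' b v w
    using that assms(5,6) tableau_entries_col[OF S, of a b v a' w] by (auto split: if_splits)
  ultimately show ?thesis unfolding tableau_entries_def by blast
qed

text \<open>
  The intermediate stages of a slide: a skew tableau with a hole \<open>c\<close>. The entries on both
  sides of the hole are compared as well, so that moving a neighbour into the hole is all that a
  step has to check. At the start the cell \<open>c\<close> has already been removed from the inner shape.
\<close>

definition punctured :: "nat \<Rightarrow> filling \<Rightarrow> cell \<Rightarrow> cell set \<Rightarrow> cell set \<Rightarrow> bool" where
  "punctured r S c outer inner \<longleftrightarrow> young_diagram outer \<and> young_diagram inner \<and> inner \<subseteq> outer \<and>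
     c \<in> outer - inner \<and> dom S = outer - inner - {c} \<and> tableau_entries r S"

text \<open>
  Unlike \<open>columns\<close>, this reading also visits empty columns; a slide may empty a column in the
  middle, and a fixed bound \<open>N\<close> keeps the column indices aligned.
\<close>

definition reading :: "nat \<Rightarrow> filling \<Rightarrow> nat list" where
  "reading N S = concat (map (column_at S) (rev [0..<N]))"

lemma column_at_eq:
  assumes "{i. (i, j) \<in> dom S} = set xs" "sorted_wrt (<) xs"
  shows "column_at S j = map (\<lambda>i. the (S (i, j))) xs"
  unfolding column_at_def assms(1)
  using assms(2) by (simp add: strict_sorted_iff sorted_list_of_set.idem_if_sorted_distinct)

lemma column_at_cong: "(\<And>i. S (i, j) = S' (i, j)) \<Longrightarrow> column_at S j = column_at S' j"
  unfolding column_at_def by (simp add: domIff)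

lemma sorted_wrt_upt_split: "sorted_wrt (<) ([a..<i] @ [Suc i..<b])"
  "sorted_wrt (<) ([a..<i] @ i # [Suc i..<b])"
  by (auto simp: sorted_wrt_append)

context
  fixes r S i j outer inner ho hi
  assumes S: "punctured r S (i, j) outer inner"
    and heights: "column_heights outer ho" "column_heights inner hi"
begin

lemma outer_heights: "(a, b) \<in> outer \<longleftrightarrow> a < ho b" "b \<le> b' \<Longrightarrow> ho b' \<le> ho b"
  and inner_heights: "(a, b) \<in> inner \<longleftrightarrow> a < hi b" "b \<le> b' \<Longrightarrow> hi b' \<le> hi b"
  using heights unfolding column_heights_def antimono_def by blast+

lemma punctured_entries: "tableau_entries r S"
  using S unfolding punctured_def by blast

lemma punctured_hole: "hi j \<le> i" "i < ho j"
  using S unfolding punctured_def by (auto simp: outer_heights inner_heights not_less)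

lemma punctured_dom: "(a, b) \<in> dom S \<longleftrightarrow> hi b \<le> a \<and> a < ho b \<and> (a, b) \<noteq> (i, j)"
  using S unfolding punctured_def by (auto simp: outer_heights inner_heights)

lemma punctured_Some:
  assumes "hi b \<le> a" "a < ho b" "(a, b) \<noteq> (i, j)"
  obtains x where "S (a, b) = Some x"
  using assms punctured_dom[of a b] by blast

text \<open>
  A vertical step leaves every column unchanged as a list. The entry moved up stays above its left
  neighbour because that neighbour is smaller than the entry below it, which is present
  since the shape is skew.
\<close>

lemma punctured_below:
  assumes x: "S (Suc i, j) = Some x" and min: "\<forall>y. S (i, Suc j) = Some y \<longrightarrow> x \<le> y"
  defines "S' \<equiv> S((i, j) := Some x, (Suc i, j) := None)"
  shows "punctured r S' (Suc i, j) outer inner" and "reading N S' = reading N S"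
proof -
  note E = punctured_entries
  have d: "hi j \<le> Suc i" "Suc i < ho j" using punctured_dom[of "Suc i" j] x by auto
  have "tableau_entries r S'" unfolding S'_def
  proof (rule tableau_entries_move[OF E x])
    fix j' w assume j': "j' < j" "S (i, j') = Some w"
    then have "hi j' \<le> Suc i" "Suc i < ho j'" "(Suc i, j') \<noteq> (i, j)"
      using punctured_dom[of i j'] d outer_heights(2)[of j' j] by auto
    then obtain v where v: "S (Suc i, j') = Some v" by (rule punctured_Some)
    show "w \<le> x"
      using tableau_entries_col[OF E j'(2) v] tableau_entries_row[OF E v x j'(1)] by simp
  next
    fix j' w assume j': "j < j'" "S (i, j') = Some w"
    then have "hi (Suc j) \<le> i" "i < ho (Suc j)" "(i, Suc j) \<noteq> (i, j)"
      using punctured_dom[of i j'] inner_heights(2)[of j "Suc j"] outer_heights(2)[of "Suc j" j'] punctured_hole by auto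
    then obtain v where v: "S (i, Suc j) = Some v" by (rule punctured_Some)
    have "v \<le> w" using tableau_entries_row[OF E v j'(2)] j' v by (cases "j' = Suc j") auto
    then show "x \<le> w" using min v by simp
  next
    fix i' w assume "i' < i" "S (i', j) = Some w"
    then show "w < x" using tableau_entries_col[OF E _ x] by simp
  next
    fix i' w assume "i < i'" "(i', j) \<noteq> (Suc i, j)" "S (i', j) = Some w"
    then show "x < w" using tableau_entries_col[OF E x, of i' w] by simp
  qed
  moreover have "dom S' = outer - inner - {(Suc i, j)}"
    using S x unfolding punctured_def S'_def by (auto simp: dom_def split: if_splits)
  ultimately show "punctured r S' (Suc i, j) outer inner"
    using S d unfolding punctured_def by (auto simp: outer_heights inner_heights)
  have "column_at S' k = column_at S k" for k
  proof (cases "k = j")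
    case False
    then show ?thesis by (intro column_at_cong) (simp add: S'_def)
  next
    case True
    have "{a. (a, j) \<in> dom S} = set ([hi j..<i] @ [Suc i..<ho j])"
      using punctured_hole by (auto simp: punctured_dom)
    from column_at_eq[OF this sorted_wrt_upt_split(1)]
    have 1: "column_at S j = map (\<lambda>i. the (S (i, j))) ([hi j..<i] @ Suc i # [Suc (Suc i)..<ho j])"
      using d by (simp add: upt_conv_Cons)
    have "{a. (a, j) \<in> dom S'} = {a. (a, j) \<in> dom S} \<union> {i} - {Suc i}"
      unfolding S'_def by (auto simp: dom_def)
    also have "\<dots> = set ([hi j..<i] @ i # [Suc (Suc i)..<ho j])"
      using punctured_hole by (auto simp: punctured_dom)
    finally have "column_at S' j = map (\<lambda>i. the (S' (i, j))) ([hi j..<i] @ i # [Suc (Suc i)..<ho j])"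
      by (rule column_at_eq) (auto simp: sorted_wrt_append)
    then show ?thesis using True 1 x by (simp add: S'_def)
  qed
  then have "column_at S' = column_at S" by (rule ext)
  then show "reading N S' = reading N S" unfolding reading_def by (rule arg_cong)
qed

text \<open>
  A horizontal step changes two adjacent columns, and their readings by \<open>knuth_slide\<close>.
  The lengths of the blocks there are the differences of the column heights.
\<close>

lemma punctured_right:
  assumes y: "S (i, Suc j) = Some y" and min: "\<forall>x. S (Suc i, j) = Some x \<longrightarrow> y < x"
  defines "S' \<equiv> S((i, j) := Some y, (i, Suc j) := None)"
  shows "punctured r S' (i, Suc j) outer inner"
    and "Suc j < N \<Longrightarrow> reading N S \<approx> reading N S'"
proof -
  note E = punctured_entries
  have d: "hi (Suc j) \<le> i" "i < ho (Suc j)" using punctured_dom[of i "Suc j"] y by auto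
  have h: "hi (Suc j) \<le> hi j" "hi j \<le> i" "Suc i \<le> ho (Suc j)" "ho (Suc j) \<le> ho j"
    using inner_heights(2)[of j "Suc j"] outer_heights(2)[of j "Suc j"] punctured_hole d by auto
  have below: "y < w" if "i < i'" "S (i', j) = Some w" for i' w
  proof -
    have "hi j \<le> Suc i" "Suc i < ho j" "(Suc i, j) \<noteq> (i, j)"
      using that h punctured_dom[of i' j] by auto
    then obtain v where v: "S (Suc i, j) = Some v" by (rule punctured_Some)
    have "v \<le> w" using tableau_entries_col[OF E v that(2)] that v by (cases "i' = Suc i") auto
    then show ?thesis using min v by simp
  qed
  have "tableau_entries r S'" unfolding S'_def
  proof (rule tableau_entries_move[OF E y])
    fix j' w assume "j' < j" "S (i, j') = Some w"
    then show "w \<le> y" using tableau_entries_row[OF E _ y] by simp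
  next
    fix j' w assume "j < j'" "(i, j') \<noteq> (i, Suc j)" "S (i, j') = Some w"
    then show "y \<le> w" using tableau_entries_row[OF E y, of j' w] by simp
  next
    fix i' w assume i': "i' < i" "S (i', j) = Some w"
    then have "hi (Suc j) \<le> i'" "i' < ho (Suc j)" "(i', Suc j) \<noteq> (i, j)"
      using punctured_dom[of i' j] h by auto
    then obtain v where v: "S (i', Suc j) = Some v" by (rule punctured_Some)
    show "w < y"
      using tableau_entries_row[OF E i'(2) v] tableau_entries_col[OF E v y i'(1)] by simp
  qed (use below in simp)
  moreover have "dom S' = outer - inner - {(i, Suc j)}"
    using S y unfolding punctured_def S'_def by (auto simp: dom_def split: if_splits)
  ultimately show "punctured r S' (i, Suc j) outer inner"
    using S d unfolding punctured_def by (auto simp: outer_heights inner_heights)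
  assume N: "Suc j < N"
  define f where "f k = the (S (k, j))" for k
  define g where "g k = the (S (k, Suc j))" for k
  have f: "S (k, j) = Some (f k)" if "hi j \<le> k" "k < ho j" "k \<noteq> i" for k
    using that iffD2[OF punctured_dom[of k j]] unfolding f_def by auto
  have g: "S (k, Suc j) = Some (g k)" if "hi (Suc j) \<le> k" "k < ho (Suc j)" for k
    using that iffD2[OF punctured_dom[of k "Suc j"]] unfolding g_def by auto
  have gi: "g i = y" using y unfolding g_def by simp
  have S'i: "S' (i, j) = Some y" by (simp add: S'_def)
  have S'f: "map (\<lambda>k. the (S' (k, j))) xs = map f xs" if "i \<notin> set xs" for xs
    using that by (auto simp: S'_def f_def)
  have S'g: "map (\<lambda>k. the (S' (k, Suc j))) xs = map g xs" if "i \<notin> set xs" for xs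
    using that by (auto simp: S'_def g_def)
  have dj: "{a. (a, j) \<in> dom S} = set ([hi j..<i] @ [Suc i..<ho j])"
    using punctured_hole by (auto simp: punctured_dom)
  then have "column_at S j = map f ([hi j..<i] @ [Suc i..<ho j])"
    unfolding f_def by (rule column_at_eq) (rule sorted_wrt_upt_split)
  also have "[Suc i..<ho j] = [Suc i..<ho (Suc j)] @ [ho (Suc j)..<ho j]"
    using upt_add_eq_append[of "Suc i" "ho (Suc j)" "ho j - ho (Suc j)"] h by simp
  finally have cj: "column_at S j = map f [hi j..<i] @ map f [Suc i..<ho (Suc j)] @ map f [ho (Suc j)..<ho j]"
    by simp
  have dsj: "{a. (a, Suc j) \<in> dom S} = set ([hi (Suc j)..<i] @ i # [Suc i..<ho (Suc j)])"
    using d by (auto simp: punctured_dom)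
  then have "column_at S (Suc j) = map g ([hi (Suc j)..<i] @ i # [Suc i..<ho (Suc j)])"
    unfolding g_def by (rule column_at_eq) (rule sorted_wrt_upt_split)
  also have split: "[hi (Suc j)..<i] = [hi (Suc j)..<hi j] @ [hi j..<i]"
    using upt_add_eq_append[of "hi (Suc j)" "hi j" "i - hi j"] h by simp
  finally have csj: "column_at S (Suc j) = map g [hi (Suc j)..<hi j] @ map g [hi j..<i] @ y # map g [Suc i..<ho (Suc j)]"
    using gi by simp
  have "{a. (a, j) \<in> dom S'} = insert i {a. (a, j) \<in> dom S}"
    unfolding S'_def by (auto simp: dom_def)
  also have "\<dots> = set ([hi j..<i] @ i # [Suc i..<ho j])" unfolding dj by auto
  finally have "column_at S' j = map (\<lambda>k. the (S' (k, j))) ([hi j..<i] @ i # [Suc i..<ho j])"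
    by (rule column_at_eq) (rule sorted_wrt_upt_split)
  also have "[Suc i..<ho j] = [Suc i..<ho (Suc j)] @ [ho (Suc j)..<ho j]"
    using upt_add_eq_append[of "Suc i" "ho (Suc j)" "ho j - ho (Suc j)"] h by simp
  finally have cj': "column_at S' j = map f [hi j..<i] @ y # map f [Suc i..<ho (Suc j)] @ map f [ho (Suc j)..<ho j]"
    using h S'i by (simp add: S'f)
  have "{a. (a, Suc j) \<in> dom S'} = {a. (a, Suc j) \<in> dom S} - {i}"
    unfolding S'_def by (auto simp: dom_def)
  also have "\<dots> = set ([hi (Suc j)..<i] @ [Suc i..<ho (Suc j)])" unfolding dsj by auto
  finally have "column_at S' (Suc j) = map (\<lambda>k. the (S' (k, Suc j))) ([hi (Suc j)..<i] @ [Suc i..<ho (Suc j)])"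
    by (rule column_at_eq) (rule sorted_wrt_upt_split)
  then have csj': "column_at S' (Suc j) = map g [hi (Suc j)..<hi j] @ map g [hi j..<i] @ map g [Suc i..<ho (Suc j)]"
    using split h by (simp add: S'g)
  have step: "column_at S (Suc j) @ column_at S j \<approx> column_at S' (Suc j) @ column_at S' j"
    unfolding cj csj cj' csj'
  proof (rule knuth_slide)
    have row: "f k \<le> g k" if "hi j \<le> k" "k < ho (Suc j)" "k \<noteq> i" for k
      using tableau_entries_row[OF E f g] that h by simp
    show "list_all2 (\<le>) (map f [hi j..<i]) (map g [hi j..<i])"
      using row h by (auto simp: list_all2_conv_all_nth)
    show "list_all2 (\<le>) (map f [Suc i..<ho (Suc j)]) (map g [Suc i..<ho (Suc j)])"
      using row h by (auto simp: list_all2_conv_all_nth)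
    have "sorted_wrt (<) (map g [hi j..<ho (Suc j)])"
      unfolding sorted_wrt_map
      by (rule sorted_wrt_mono_rel[OF _ sorted_wrt_upt])
        (use h in \<open>auto intro: tableau_entries_col[OF E g g]\<close>)
    also have "[hi j..<ho (Suc j)] = [hi j..<i] @ i # [Suc i..<ho (Suc j)]"
      using upt_add_eq_append[of "hi j" i "ho (Suc j) - i"] h by (simp add: upt_conv_Cons)
    finally show "sorted_wrt (<) (map g [hi j..<i] @ y # map g [Suc i..<ho (Suc j)])"
      using gi by simp
    have "sorted_wrt (<) (map f [Suc i..<ho (Suc j)])"
      unfolding sorted_wrt_map
      by (rule sorted_wrt_mono_rel[OF _ sorted_wrt_upt])
        (use h in \<open>auto intro: tableau_entries_col[OF E f f]\<close>)
    then show "sorted_wrt (<) (y # map f [Suc i..<ho (Suc j)])"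
      using h below[OF _ f] by auto
  qed
  have other: "column_at S k = column_at S' k" if "k \<noteq> j" "k \<noteq> Suc j" for k
    by (rule column_at_cong) (use that in \<open>simp add: S'_def\<close>)
  have "[0..<N] = [0..<j] @ [j, Suc j] @ [Suc (Suc j)..<N]"
    using N upt_add_eq_append[of 0 j "N - j"] by (simp add: upt_conv_Cons)
  then have R: "reading N F = concat (map (column_at F) (rev [Suc (Suc j)..<N])) @
      (column_at F (Suc j) @ column_at F j) @ concat (map (column_at F) (rev [0..<j]))" for F
    unfolding reading_def by simp
  have "map (column_at S) (rev [Suc (Suc j)..<N]) = map (column_at S') (rev [Suc (Suc j)..<N])"
    "map (column_at S) (rev [0..<j]) = map (column_at S') (rev [0..<j])"
    by (auto intro: other)
  then show "reading N S \<approx> reading N S'"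
    unfolding R by (simp only:) (rule knuth_append1[OF knuth_append2[OF step]])
qed

end

lemma slide_knuth:
  assumes "slide S c S'" "punctured r S c outer inner" "\<forall>a b. (a, b) \<in> outer \<longrightarrow> b < N"
  shows "\<exists>c'. c' \<in> outer - inner \<and> young_diagram (outer - {c'}) \<and> dom S' = outer - inner - {c'} \<and>
    tableau_entries r S' \<and> reading N S \<approx> reading N S'"
  using assms
proof (induction rule: slide.induct)
  case (stop S i j)
  then have P: "young_diagram outer" "young_diagram inner" "(i, j) \<in> outer - inner"
    "dom S = outer - inner - {(i, j)}" "tableau_entries r S"
    unfolding punctured_def by auto
  have 1: "(Suc i, j) \<notin> outer" "(i, Suc j) \<notin> outer"
  proof -
    have "(Suc i, j) \<notin> inner" "(i, Suc j) \<notin> inner"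
      using P(2,3) unfolding young_diagram_def by (meson DiffD2 le_SucI order.refl)+
    moreover have "(Suc i, j) \<notin> outer - inner - {(i, j)}" "(i, Suc j) \<notin> outer - inner - {(i, j)}"
      using stop(1,2) unfolding P(4)[symmetric] by auto
    ultimately show "(Suc i, j) \<notin> outer" "(i, Suc j) \<notin> outer" by auto
  qed
  have "young_diagram (outer - {(i, j)})"
    unfolding young_diagram_def
  proof (intro conjI allI impI)
    show "finite (outer - {(i, j)})" using P(1) by (simp add: young_diagram_def)
    fix a b a' b' assume ab: "(a, b) \<in> outer - {(i, j)}" "a' \<le> a" "b' \<le> b"
    then have "(a', b') \<in> outer" using P(1) unfolding young_diagram_def by blast
    moreover have "(a', b') \<noteq> (i, j)"
    proof
      assume "(a', b') = (i, j)"
      then have "Suc i \<le> a \<and> j \<le> b \<or> i \<le> a \<and> Suc j \<le> b" using ab by auto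
      then show False using P(1) 1 ab(1) unfolding young_diagram_def by blast
    qed
    ultimately show "(a', b') \<in> outer - {(i, j)}" by simp
  qed
  then show ?case using P knuth_refl by blast
next
  case (below S i j x S')
  have young: "young_diagram outer" "young_diagram inner"
    using below.prems(1) unfolding punctured_def by blast+
  obtain ho where ho: "column_heights outer ho" using young_diagram_heights[OF young(1)] .
  obtain hi where hi: "column_heights inner hi" using young_diagram_heights[OF young(2)] .
  have "\<forall>y. S (i, Suc j) = Some y \<longrightarrow> x \<le> y" using below.hyps(2) by blast
  note * = punctured_below[OF below.prems(1) ho hi below.hyps(1) this]
  show ?case using below.IH[OF *(1) below.prems(2)] unfolding *(2) .
next
  case (right S i j y S')
  have young: "young_diagram outer" "young_diagram inner"
    using right.prems(1) unfolding punctured_def by blast+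
  obtain ho where ho: "column_heights outer ho" using young_diagram_heights[OF young(1)] .
  obtain hi where hi: "column_heights inner hi" using young_diagram_heights[OF young(2)] .
  have "\<forall>x. S (Suc i, j) = Some x \<longrightarrow> y < x" using right.hyps(2) by blast
  note * = punctured_right[OF right.prems(1) ho hi right.hyps(1) this]
  have "(i, Suc j) \<in> outer" using right.hyps(1) right.prems(1) unfolding punctured_def by blast
  then have "Suc j < N" using right.prems(2) by blast
  from right.IH[OF *(1) right.prems(2)] knuth_trans[OF *(2)[OF this]] show ?case by blast
qed

text \<open>The hole moves away from the corner of the diagram, so \<open>i + j\<close> increases up to a bound \<open>M\<close>.\<close>

lemma slide_exists:
  assumes "punctured r S c outer inner"
  shows "\<exists>S'. slide S c S'"
proof -
  have young: "young_diagram outer" "young_diagram inner" using assms unfolding punctured_def by auto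
  obtain ho where ho: "column_heights outer ho" using young_diagram_heights[OF young(1)] .
  obtain hi where hi: "column_heights inner hi" using young_diagram_heights[OF young(2)] .
  have "finite ((\<lambda>(a, b). a + b) ` outer)" using young by (auto simp: young_diagram_def)
  then obtain M where M: "\<forall>n\<in>(\<lambda>(a, b). a + b) ` outer. n < M"
    unfolding finite_nat_set_iff_bounded by blast
  show ?thesis using assms
  proof (induction "M - (fst c + snd c)" arbitrary: S c rule: less_induct)
    case less
    obtain i j where c: "c = (i, j)" by fastforce
    note P = less.prems[unfolded c]
    have cM: "i + j < M" using M P unfolding punctured_def by force
    consider "S (Suc i, j) = None" "S (i, Suc j) = None"
      | x where "S (Suc i, j) = Some x" "\<forall>y. S (i, Suc j) = Some y \<longrightarrow> x \<le> y"
      | y where "S (i, Suc j) = Some y" "\<forall>x. S (Suc i, j) = Some x \<longrightarrow> y < x"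
      by (cases "S (Suc i, j)"; cases "S (i, Suc j)") (auto simp: not_le[symmetric])
    then show ?case
    proof cases
      case 1
      then show ?thesis unfolding c by (blast intro: slide.stop)
    next
      case (2 x)
      have "M - (Suc i + j) < M - (i + j)" using cM by simp
      then obtain S' where "slide (S((i, j) := Some x, (Suc i, j) := None)) (Suc i, j) S'"
        using less.hyps[OF _ punctured_below(1)[OF P ho hi 2]] unfolding c by auto
      then have "slide S (i, j) S'" using 2 by (blast intro: slide.below)
      then show ?thesis unfolding c by blast
    next
      case (3 y)
      have "M - (i + Suc j) < M - (i + j)" using cM by simp
      then obtain S' where "slide (S((i, j) := Some y, (i, Suc j) := None)) (i, Suc j) S'"
        using less.hyps[OF _ punctured_right(1)[OF P ho hi 3]] unfolding c by auto
      then have "slide S (i, j) S'" using 3 by (blast intro: slide.right)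
      then show ?thesis unfolding c by blast
    qed
  qed
qed

abbreviation column_word :: "filling \<Rightarrow> nat list" where
  "column_word S \<equiv> concat (rev (columns S))"

lemma reading_eq_column_word:
  assumes "\<forall>a b. (a, b) \<in> dom S \<longrightarrow> b < N"
  shows "reading N S = column_word S"
proof -
  let ?A = "snd ` dom S"
  have sub: "?A \<subseteq> {0..<N}" using assms by auto (metis domI)
  then have "finite ?A" by (rule finite_subset) simp
  moreover have "set (filter (\<lambda>j. j \<in> ?A) [0..<N]) = ?A"
    unfolding set_filter set_upt using sub by blast
  ultimately have A: "sorted_list_of_set ?A = filter (\<lambda>j. j \<in> ?A) [0..<N]"
    by (intro sorted_distinct_set_unique) (simp_all add: sorted_wrt_filter)
  have "column_at S j = []" if "j \<notin> ?A" for j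
  proof -
    have "{i. (i, j) \<in> dom S} = {}" using that by force
    then show ?thesis unfolding column_at_def by (simp only: sorted_list_of_set_empty list.map)
  qed
  then have "concat (map (column_at S) (rev xs)) = concat (map (column_at S) (rev (filter (\<lambda>j. j \<in> ?A) xs)))" for xs
    by (induction xs) auto
  then show ?thesis unfolding reading_def columns_def A by (simp add: rev_map)
qed

lemma jdt_slide_knuth:
  assumes S: "skew_tableau r S" and "jdt_slide S S'"
  shows "skew_tableau r S'" "column_word S \<approx> column_word S'"
proof -
  obtain outer inner c where sh: "skew_shape (dom S) outer inner" "c \<in> inner"
      "young_diagram (inner - {c})" "slide S c S'"
    using assms(2) unfolding jdt_slide_def by blast
  have P: "punctured r S c outer (inner - {c})"
    using sh S unfolding punctured_def skew_tableau_iff skew_shape_def by auto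
  have "finite (snd ` outer)" using sh(1) by (simp add: skew_shape_def young_diagram_def)
  then obtain N where N: "\<forall>j\<in>snd ` outer. j < N" unfolding finite_nat_set_iff_bounded by blast
  then have N': "\<forall>a b. (a, b) \<in> outer \<longrightarrow> b < N" by force
  obtain c' where c': "c' \<in> outer - (inner - {c})" "young_diagram (outer - {c'})"
      "dom S' = outer - (inner - {c}) - {c'}" "tableau_entries r S'" "reading N S \<approx> reading N S'"
    using slide_knuth[OF sh(4) P N'] by blast
  have "skew_shape (dom S') (outer - {c'}) (inner - {c})"
    using sh(1,3) c'(1-3) unfolding skew_shape_def by blast
  then show "skew_tableau r S'" using c'(4) unfolding skew_tableau_iff by blast
  have "reading N S = column_word S"
    by (rule reading_eq_column_word) (use N' sh(1) in \<open>auto simp: skew_shape_def\<close>)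
  moreover have "reading N S' = column_word S'"
    by (rule reading_eq_column_word) (use N' c'(3) in auto)
  ultimately show "column_word S \<approx> column_word S'" using c'(5) by simp
qed

lemma jdt_knuth:
  assumes "jdt_slide\<^sup>*\<^sup>* S T" "skew_tableau r S"
  shows "skew_tableau r T \<and> column_word S \<approx> column_word T"
  using assms
proof (induction rule: rtranclp_induct)
  case base
  then show ?case by (simp add: knuth_refl)
next
  case (step T U)
  then have T: "skew_tableau r T" "column_word S \<approx> column_word T" by simp_all
  show ?case using jdt_slide_knuth[OF T(1) step(2)] knuth_trans[OF T(2)] by blast
qed

lemma young_diagram_corner:
  assumes "young_diagram D" "D \<noteq> {}"
  obtains c where "c \<in> D" "young_diagram (D - {c})"
proof -
  let ?f = "\<lambda>(a, b). a + b :: nat"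
  have fin: "finite D" using assms(1) by (simp add: young_diagram_def)
  then have "Max (?f ` D) \<in> ?f ` D" using assms(2) by (intro Max_in) auto
  then obtain i j where ij: "(i, j) \<in> D" "Max (?f ` D) = i + j" by auto
  have max: "a + b \<le> i + j" if "(a, b) \<in> D" for a b
    using Max_ge[of "?f ` D" "a + b"] fin that ij(2) by force
  have "young_diagram (D - {(i, j)})"
    unfolding young_diagram_def
  proof (intro conjI allI impI)
    show "finite (D - {(i, j)})" using fin by simp
    fix a b a' b' assume ab: "(a, b) \<in> D - {(i, j)}" "a' \<le> a" "b' \<le> b"
    then have "(a', b') \<in> D" using assms(1) unfolding young_diagram_def by blast
    moreover have "(a', b') \<noteq> (i, j)" using max[of a b] ab by auto
    ultimately show "(a', b') \<in> D - {(i, j)}" by simp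
  qed
  then show ?thesis using that ij(1) by blast
qed

text \<open>Each slide into a corner removes one cell from the inner shape.\<close>

lemma rectification_exists:
  assumes "skew_tableau r S"
  shows "\<exists>T. rectifies_to S T"
proof -
  obtain outer inner where "skew_shape (dom S) outer inner" "tableau_entries r S"
    using assms unfolding skew_tableau_iff by blast
  then show ?thesis
  proof (induction "card inner" arbitrary: S outer inner)
    case 0
    then have "inner = {}" by (auto simp: skew_shape_def young_diagram_def)
    then have "young_diagram (dom S)" using 0 by (simp add: skew_shape_def)
    then show ?case unfolding rectifies_to_def by blast
  next
    case (Suc n)
    have young: "young_diagram inner" "finite inner" "inner \<noteq> {}"
      using Suc.prems(1) Suc.hyps(2) by (auto simp: skew_shape_def young_diagram_def)
    obtain c where c: "c \<in> inner" "young_diagram (inner - {c})"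
      by (rule young_diagram_corner[OF young(1,3)])
    have P: "punctured r S c outer (inner - {c})"
      using Suc.prems c unfolding punctured_def skew_shape_def by auto
    obtain S' where S': "slide S c S'" using slide_exists[OF P] by blast
    have "finite (snd ` outer)" using Suc.prems(1) by (simp add: skew_shape_def young_diagram_def)
    then obtain N where "\<forall>j\<in>snd ` outer. j < N" unfolding finite_nat_set_iff_bounded by blast
    then have N: "\<forall>a b. (a, b) \<in> outer \<longrightarrow> b < N" by force
    obtain c' where c': "c' \<in> outer - (inner - {c})" "young_diagram (outer - {c'})"
        "dom S' = outer - (inner - {c}) - {c'}" "tableau_entries r S'"
      using slide_knuth[OF S' P N] by blast
    have "skew_shape (dom S') (outer - {c'}) (inner - {c})"
      using Suc.prems(1) c(2) c'(1-3) unfolding skew_shape_def by blast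
    moreover have "n = card (inner - {c})" using Suc.hyps(2) young(2) c(1) by simp
    ultimately obtain T where T: "rectifies_to S' T" using Suc.hyps(1) c'(4) by blast
    have "jdt_slide S S'" using Suc.prems(1) c S' unfolding jdt_slide_def by blast
    then show ?case using T unfolding rectifies_to_def by (meson converse_rtranclp_into_rtranclp)
  qed
qed

lemma finite_dom_skew: "skew_tableau r S \<Longrightarrow> finite (dom S)"
  unfolding skew_tableau_iff skew_shape_def young_diagram_def by auto

lemma skew_tableau_columns:
  assumes S: "skew_tableau r S"
  shows "[] \<notin> set (columns S)"
    and "rev (columns S) \<in> carrier (column_tensor r (map length (rev (columns S))))"
proof -
  have fin: "finite (dom S)" by (rule finite_dom_skew[OF S])
  have E: "tableau_entries r S" using S unfolding skew_tableau_iff by blast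
  have col: "column_at S j \<noteq> [] \<and> sorted_wrt (<) (column_at S j) \<and> set (column_at S j) \<subseteq> {1..Suc r}"
    if j: "j \<in> snd ` dom S" for j
  proof -
    let ?A = "{i. (i, j) \<in> dom S}"
    have "?A \<subseteq> fst ` dom S" by force
    then have fA: "finite ?A" using fin by (meson finite_imageI finite_subset)
    have "?A \<noteq> {}" using j by force
    then have "column_at S j \<noteq> []" using fA unfolding column_at_def by simp
    moreover have "set (column_at S j) \<subseteq> ran S"
      using fA unfolding column_at_def by (auto intro: ranI)
    then have "set (column_at S j) \<subseteq> {1..Suc r}" using E unfolding tableau_entries_def by blast
    moreover have "sorted_wrt (<) (column_at S j)"
      unfolding column_at_def sorted_wrt_map
      by (rule sorted_wrt_mono_rel[OF _ strict_sorted_list_of_set])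
        (use fA in \<open>auto intro: tableau_entries_col[OF E]\<close>)
    ultimately show ?thesis by blast
  qed
  have fin': "finite (snd ` dom S)" using fin by simp
  have cols: "set (columns S) = column_at S ` snd ` dom S" using fin' unfolding columns_def by simp
  show "[] \<notin> set (columns S)"
  proof
    assume "[] \<in> set (columns S)"
    then obtain j where "j \<in> snd ` dom S" "column_at S j = []" unfolding cols by (metis imageE)
    then show False using col by blast
  qed
  show "rev (columns S) \<in> carrier (column_tensor r (map length (rev (columns S))))"
    unfolding carrier_column_tensor set_rev cols using col by blast
qed

lemma dom_of_columns: "dom (of_columns Cs) = {(i, j). j < length Cs \<and> i < length (Cs ! j)}"
  unfolding of_columns_def by (auto split: if_splits)

lemma columns_of_columns:
  assumes "[] \<notin> set Cs"
  shows "columns (of_columns Cs) = Cs"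
proof -
  have ne: "0 < length (Cs ! j)" if "j < length Cs" for j
    using that assms nth_mem by fastforce
  have "snd ` dom (of_columns Cs) = {0..<length Cs}"
    unfolding dom_of_columns using ne by force
  moreover have "column_at (of_columns Cs) j = Cs ! j" if "j < length Cs" for j
  proof -
    have "column_at (of_columns Cs) j = map (\<lambda>i. the (of_columns Cs (i, j))) [0..<length (Cs ! j)]"
      by (rule column_at_eq) (use that in \<open>auto simp: dom_of_columns\<close>)
    also have "\<dots> = Cs ! j"
      by (rule nth_equalityI) (use that in \<open>auto simp: of_columns_def\<close>)
    finally show ?thesis .
  qed
  ultimately show ?thesis
    unfolding columns_def by (intro nth_equalityI) (simp_all)
qed

lemma young_filling_columns:
  assumes "young_diagram (dom T)"
  obtains h m where "column_heights (dom T) h" "\<And>j. j < m \<longleftrightarrow> 0 < h j"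
    "columns T = map (column_at T) [0..<m]"
    "\<And>j. column_at T j = map (\<lambda>i. the (T (i, j))) [0..<h j]"
proof -
  obtain h where h: "column_heights (dom T) h" by (rule young_diagram_heights[OF assms])
  then have dom: "(i, j) \<in> dom T \<longleftrightarrow> i < h j" and anti: "j \<le> j' \<Longrightarrow> h j' \<le> h j" for i j j'
    unfolding column_heights_def antimono_def by blast+
  have "finite (snd ` dom T)" using assms by (simp add: young_diagram_def)
  then obtain N where N: "\<forall>j\<in>snd ` dom T. j < N" unfolding finite_nat_set_iff_bounded by blast
  have "h N = 0" using N dom[of 0 N] by force
  define m where "m = (LEAST j. h j = 0)"
  have hm: "h m = 0" unfolding m_def by (rule LeastI) fact
  have m: "j < m \<longleftrightarrow> 0 < h j" for j
    using not_less_Least[of j "\<lambda>j. h j = 0"] anti[of m j] hm unfolding m_def[symmetric]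
    by (metis gr0I leI le_zero_eq less_irrefl)
  have "snd ` dom T = {0..<m}"
  proof
    show "snd ` dom T \<subseteq> {0..<m}" using dom m by auto (metis domI gr_zeroI not_less0)
    show "{0..<m} \<subseteq> snd ` dom T" using dom[of 0] m by (auto simp: image_iff) (metis domD snd_conv)
  qed
  then have "columns T = map (column_at T) [0..<m]" unfolding columns_def by simp
  moreover have "column_at T j = map (\<lambda>i. the (T (i, j))) [0..<h j]" for j
    by (rule column_at_eq) (auto simp: dom)
  ultimately show ?thesis using that h m by blast
qed

lemma of_columns_columns:
  assumes "young_diagram (dom T)"
  shows "of_columns (columns T) = T"
proof
  fix c :: cell
  obtain h m where h: "column_heights (dom T) h" and m: "\<And>j. j < m \<longleftrightarrow> 0 < h j"
    and col: "columns T = map (column_at T) [0..<m]"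
      "\<And>j. column_at T j = map (\<lambda>i. the (T (i, j))) [0..<h j]"
    by (rule young_filling_columns[OF assms]) (rule that)
  obtain i j where c: "c = (i, j)" by fastforce
  have dom: "(i, j) \<in> dom T \<longleftrightarrow> i < h j" using h unfolding column_heights_def by blast
  show "of_columns (columns T) c = T c"
  proof (cases "i < h j")
    case True
    then show ?thesis using dom m[of j] unfolding c of_columns_def col by auto
  next
    case False
    then show ?thesis using dom unfolding c of_columns_def col by (auto simp: domIff)
  qed
qed

section \<open>Rectification is determined by the Knuth class\<close>

text \<open>\<open>D\<close> can stand immediately to the right of \<open>C\<close> in a tableau; readings list \<open>D\<close> first.\<close>

definition row_le :: "column \<Rightarrow> column \<Rightarrow> bool" where
  "row_le D C \<longleftrightarrow> length D \<le> length C \<and> (\<forall>k<length D. C ! k \<le> D ! k)"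

text \<open>
  The operator could only break a row with \<open>i + 1\<close> in both columns. As \<open>C\<close> has no unmatched
  \<open>i + 1\<close>, it has an \<open>i\<close> further up; in that row \<open>D\<close> would also have an \<open>i\<close>, and then
  the operator would not act on \<open>D\<close>.
\<close>

lemma row_le_E_right:
  assumes "sorted_wrt (<) C" "sorted_wrt (<) D" "row_le D C" "word_E i D = Some D'" "word_eps i C = 0"
  shows "row_le D' C"
proof -
  have D: "i \<notin> set D" "D' = map (\<lambda>x. if x = Suc i then i else x) D"
    using assms(4) column_ops(3)[OF assms(2), of i] by (auto split: if_splits)
  have C: "Suc i \<in> set C \<Longrightarrow> i \<in> set C"
    using assms(5) column_ops(1)[OF assms(1), of i] by (auto split: if_splits)
  have len: "length D \<le> length C" and le: "\<And>k. k < length D \<Longrightarrow> C ! k \<le> D ! k"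
    using assms(3) unfolding row_le_def by auto
  have "C ! k \<noteq> Suc i" if k: "k < length D" "D ! k = Suc i" for k
  proof
    assume Ck: "C ! k = Suc i"
    then obtain l where l: "l < length C" "C ! l = i"
      using C k(1) len by (metis in_set_conv_nth less_le_trans)
    have lk: "l < k"
    proof (rule ccontr)
      assume "\<not> l < k"
      then have "C ! k \<le> C ! l"
        using sorted_wrt_nth_less[OF assms(1), of k l] l(1) by (cases "l = k") auto
      then show False using Ck l(2) by simp
    qed
    then have "i \<le> D ! l" "D ! l < Suc i"
      using le[of l] l(2) k sorted_wrt_nth_less[OF assms(2) lk] by auto
    then have "D ! l = i" by simp
    then show False using D(1) lk k(1) nth_mem[of l D] by simp
  qed
  then have "C ! k \<le> D' ! k" if "k < length D" for k
    using that le[OF that] by (auto simp: D(2) le_Suc_eq)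
  then show ?thesis using len unfolding row_le_def by (simp add: D(2))
qed

text \<open>
  The same argument downwards: an \<open>i\<close> in the same row of \<open>D\<close> is matched by an \<open>i + 1\<close> below it,
  which forces an \<open>i + 1\<close> in \<open>C\<close>.
\<close>

lemma row_le_F_left:
  assumes "sorted_wrt (<) C" "sorted_wrt (<) D" "row_le D C" "word_F i C = Some C'" "word_phi i D = 0"
  shows "row_le D C'"
proof -
  have C: "Suc i \<notin> set C" "C' = map (\<lambda>x. if x = i then Suc i else x) C"
    using assms(4) column_ops(4)[OF assms(1), of i] by (auto split: if_splits)
  have D: "i \<in> set D \<Longrightarrow> Suc i \<in> set D"
    using assms(5) column_ops(2)[OF assms(2), of i] by (auto split: if_splits)
  have len: "length D \<le> length C" and le: "\<And>k. k < length D \<Longrightarrow> C ! k \<le> D ! k"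
    using assms(3) unfolding row_le_def by auto
  have "D ! k \<noteq> i" if k: "k < length D" "C ! k = i" for k
  proof
    assume Dk: "D ! k = i"
    then obtain l where l: "l < length D" "D ! l = Suc i"
      using D k(1) by (metis in_set_conv_nth)
    have kl: "k < l"
    proof (rule ccontr)
      assume "\<not> k < l"
      then have "D ! l \<le> D ! k"
        using sorted_wrt_nth_less[OF assms(2), of l k] k(1) by (cases "l = k") auto
      then show False using Dk l(2) by simp
    qed
    then have "C ! l \<le> Suc i" "i < C ! l"
      using le[of l] l len k sorted_wrt_nth_less[OF assms(1) kl] by auto
    then have "C ! l = Suc i" by simp
    then show False using C(1) l(1) len nth_mem[of l C] by simp
  qed
  then have "C' ! k \<le> D ! k" if "k < length D" for k
    using that le[OF that] len by (fastforce simp: C(2))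
  then show ?thesis using len unfolding row_le_def by (simp add: C(2))
qed

lemma row_le_E_left:
  assumes "sorted_wrt (<) C" "row_le D C" "word_E i C = Some C'"
  shows "row_le D C'"
  using assms(2,3) column_ops(3)[OF assms(1), of i] unfolding row_le_def
  by (auto split: if_splits)

lemma row_le_F_right:
  assumes "sorted_wrt (<) D" "row_le D C" "word_F i D = Some D'"
  shows "row_le D' C"
  using assms(2,3) column_ops(4)[OF assms(1), of i] unfolding row_le_def
  by (fastforce split: if_splits)

lemma column_tensor_Cons:
  assumes i: "i \<in> {1..r}" and D: "D # b \<in> carrier (column_tensor r (k # ks))"
  shows "Eop (column_tensor r (k # ks)) i (D # b) =
      (if word_eps i (concat b) \<le> word_phi i D then map_option (\<lambda>D'. D' # b) (word_E i D)
       else map_option ((#) D) (Eop (column_tensor r ks) i b))"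
    and "Fop (column_tensor r (k # ks)) i (D # b) =
      (if word_eps i (concat b) < word_phi i D then map_option (\<lambda>D'. D' # b) (word_F i D)
       else map_option ((#) D) (Fop (column_tensor r ks) i b))"
proof -
  have mem: "D \<in> carrier (column_crystal r k)" "b \<in> carrier (column_tensor r ks)"
    using D unfolding carrier_column_tensor carrier_column_crystal by auto
  have "Eop (column_crystal r k) i D = word_E i D" "Fop (column_crystal r k) i D = word_F i D"
    using reads_E_map[OF reads_column_crystal i mem(1)] reads_F_map[OF reads_column_crystal i mem(1)]
    by (simp_all add: option.map_ident)
  moreover have "phi (column_crystal r k) i D = word_phi i D" "eps (column_tensor r ks) i b = word_eps i (concat b)"
    using reads_phi[OF reads_column_crystal i mem(1)] reads_eps[OF reads_column_tensor i mem(2)] by auto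
  ultimately show "Eop (column_tensor r (k # ks)) i (D # b) =
      (if word_eps i (concat b) \<le> word_phi i D then map_option (\<lambda>D'. D' # b) (word_E i D)
       else map_option ((#) D) (Eop (column_tensor r ks) i b))"
    "Fop (column_tensor r (k # ks)) i (D # b) =
      (if word_eps i (concat b) < word_phi i D then map_option (\<lambda>D'. D' # b) (word_F i D)
       else map_option ((#) D) (Fop (column_tensor r ks) i b))"
    by (simp_all add: transport_def tensor_def option.map_comp comp_def)
qed

text \<open>
  The crystal operators preserve semistandardness. If the operator acts on \<open>D\<close>, the tensor product
  rule says that nothing to the left has an unmatched \<open>i + 1\<close>, which is what
  \<open>row_le_E_right\<close> needs. The information on the head lets the induction see how the
  left neighbour of \<open>D\<close> changes.
\<close>

lemma tableau_E:
  assumes i: "i \<in> {1..r}"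
    and "b \<in> carrier (column_tensor r ks)" "successively row_le b"
    and "Eop (column_tensor r ks) i b = Some b'"
  shows "successively row_le b' \<and> b \<noteq> [] \<and> b' \<noteq> [] \<and> (hd b' = hd b \<or> word_E i (hd b) = Some (hd b'))"
  using assms(2-)
proof (induction b arbitrary: b' ks)
  case Nil
  then show ?case unfolding carrier_column_tensor by simp
next
  case (Cons D b)
  obtain k l where ks: "ks = k # l" using Cons.prems(1) unfolding carrier_column_tensor by auto
  have b: "b \<in> carrier (column_tensor r l)" and D: "sorted_wrt (<) D"
    and sorted: "\<And>C. C \<in> set b \<Longrightarrow> sorted_wrt (<) C"
    using Cons.prems(1) unfolding ks carrier_column_tensor by auto
  note E = Cons.prems(3)[unfolded ks column_tensor_Cons(1)[OF i Cons.prems(1)[unfolded ks]]]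
  have row: "row_le D C" if "b = C # c" for C c using Cons.prems(2) that by simp
  have succ: "successively row_le b" using Cons.prems(2) by (cases b) auto
  show ?case
  proof (cases "word_eps i (concat b) \<le> word_phi i D")
    case True
    then obtain D' where D': "word_E i D = Some D'" "b' = D' # b" using E by auto
    have "Suc i \<in> set D \<and> i \<notin> set D" using D'(1) column_ops(3)[OF D, of i] by (auto split: if_splits)
    then have "word_phi i D = 0" using column_ops(2)[OF D, of i] by simp
    then have "word_eps i (concat b) = 0" using True by simp
    then have "row_le D' C" if "b = C # c" for C c
      using row_le_E_right[OF _ D row[OF that] D'(1)] sorted that by (simp add: word_eps_append)
    then show ?thesis using D' succ by (cases b) auto
  next
    case False
    then obtain c where c: "Eop (column_tensor r l) i b = Some c" "b' = D # c" using E by auto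
    from Cons.IH[OF b succ c(1)] have IH: "successively row_le c" "b \<noteq> []" "c \<noteq> []"
      "hd c = hd b \<or> word_E i (hd b) = Some (hd c)" by auto
    have "row_le D (hd b)" using row[of "hd b" "tl b"] IH(2) by simp
    then have "row_le D (hd c)"
      using IH(4) row_le_E_left[OF sorted[of "hd b"]] IH(2) by auto
    then show ?thesis using c(2) IH by (cases c) auto
  qed
qed

text \<open>
  If the operator acts on the left neighbour of \<open>D\<close> but not on \<open>D\<close>, then \<open>word_eps\<close> of everything
  left of \<open>D\<close> vanishes and the tensor product rule gives \<open>word_phi i D = 0\<close>, as
  \<open>row_le_F_left\<close> needs. This is why the conclusion also records \<open>word_eps\<close>.
\<close>

lemma tableau_F:
  assumes i: "i \<in> {1..r}"
    and "b \<in> carrier (column_tensor r ks)" "successively row_le b"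
    and "Fop (column_tensor r ks) i b = Some b'"
  shows "successively row_le b' \<and> b \<noteq> [] \<and> b' \<noteq> [] \<and>
    (hd b' = hd b \<or> word_F i (hd b) = Some (hd b') \<and> word_eps i (concat b) = 0)"
  using assms(2-)
proof (induction b arbitrary: b' ks)
  case Nil
  then show ?case unfolding carrier_column_tensor by simp
next
  case (Cons D b)
  obtain k l where ks: "ks = k # l" using Cons.prems(1) unfolding carrier_column_tensor by auto
  have b: "b \<in> carrier (column_tensor r l)" and D: "sorted_wrt (<) D"
    and sorted: "\<And>C. C \<in> set b \<Longrightarrow> sorted_wrt (<) C"
    using Cons.prems(1) unfolding ks carrier_column_tensor by auto
  note F = Cons.prems(3)[unfolded ks column_tensor_Cons(2)[OF i Cons.prems(1)[unfolded ks]]]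
  have row: "row_le D C" if "b = C # c" for C c using Cons.prems(2) that by simp
  have succ: "successively row_le b" using Cons.prems(2) by (cases b) auto
  show ?case
  proof (cases "word_eps i (concat b) < word_phi i D")
    case True
    then obtain D' where D': "word_F i D = Some D'" "b' = D' # b" using F by auto
    have "i \<in> set D \<and> Suc i \<notin> set D" using D'(1) column_ops(4)[OF D, of i] by (auto split: if_splits)
    then have "word_eps i D = 0" "word_phi i D = 1" using column_ops(1,2)[OF D, of i] by simp_all
    then have "word_eps i (concat (D # b)) = 0" using True by (simp add: word_eps_append)
    moreover have "row_le D' C" if "b = C # c" for C c
      using row_le_F_right[OF D row[OF that] D'(1)] .
    ultimately show ?thesis using D' succ by (cases b) auto
  next
    case False
    then obtain c where c: "Fop (column_tensor r l) i b = Some c" "b' = D # c" using F by auto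
    from Cons.IH[OF b succ c(1)] have IH: "successively row_le c" "b \<noteq> []" "c \<noteq> []"
      "hd c = hd b \<or> word_F i (hd b) = Some (hd c) \<and> word_eps i (concat b) = 0" by auto
    have *: "row_le D (hd b)" using row[of "hd b" "tl b"] IH(2) by simp
    have "row_le D (hd c)"
      using IH(4)
    proof
      assume h: "word_F i (hd b) = Some (hd c) \<and> word_eps i (concat b) = 0"
      then have "word_phi i D = 0" using False by simp
      then show ?thesis
        by (rule row_le_F_left[OF sorted[OF hd_in_set[OF IH(2)]] D * conjunct1[OF h]])
    qed (use * in simp)
    then show ?thesis using c(2) IH by (cases c) auto
  qed
qed

abbreviation tableau_crystal :: "nat \<Rightarrow> nat list \<Rightarrow> column list crystal" where
  "tableau_crystal r ks \<equiv> (column_tensor r ks)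
     \<lparr>carrier := {b \<in> carrier (column_tensor r ks). successively row_le b}\<rparr>"

lemma reads_tableau_crystal: "reads r (tableau_crystal r ks) concat"
proof (rule reads_subcrystal[OF reads_column_tensor])
  fix i b c
  assume i: "i \<in> {1..r}" and b: "b \<in> {b \<in> carrier (column_tensor r ks). successively row_le b}"
    and c: "c \<in> carrier (column_tensor r ks)"
  show "c \<in> {b \<in> carrier (column_tensor r ks). successively row_le b}"
    if "Eop (column_tensor r ks) i b = Some c"
    using tableau_E[OF i _ _ that] b c by simp
  show "c \<in> {b \<in> carrier (column_tensor r ks). successively row_le b}"
    if "Fop (column_tensor r ks) i b = Some c"
    using tableau_F[OF i _ _ that] b c by simp
qed simp

lemma word_eps_hw_word: "0 < i \<Longrightarrow> word_eps i (hw_word ks) = 0"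
proof (induction ks)
  case (Cons k ks)
  have "sorted_wrt (<) (hw_column k)" by (rule sorted_wrt_upt)
  then have "word_eps i (hw_column k) = 0"
    using column_ops(1)[of "hw_column k" i] Cons.prems by (simp del: upt_Suc)
  then show ?case using Cons by (simp add: word_eps_append del: upt_Suc)
qed simp

lemma word_eps_prefix: "word_eps i u \<le> word_eps i (u @ v)"
  by (simp add: word_eps_append)

lemma row_le_length_sorted:
  assumes "successively row_le b"
  shows "sorted (map length b)"
proof -
  have "successively (\<le>) (map length b)"
    unfolding successively_map
    by (rule successively_mono[OF assms]) (simp add: row_le_def)
  then show ?thesis by (simp add: successively_conv_sorted_wrt transp_on_le)
qed

text \<open>
  By induction from the right the columns are $(1,\dots,k)$. In the rows shared with the column
  to its right, the new column is bounded by that column. Below them, the first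
  entry $i + 1$ that is too large would occur without any $i$ before it in the reading, and would be
  unmatched.
\<close>

lemma hw_tableau:
  assumes "b \<in> carrier (column_tensor r ks)" "successively row_le b"
    and "\<forall>i\<in>{1..r}. word_eps i (concat b) = 0"
  shows "b = map hw_column ks"
proof -
  have cols: "\<forall>C\<in>set b. sorted_wrt (<) C \<and> set C \<subseteq> {1..Suc r}" and ks: "ks = map length b"
    using assms(1) unfolding carrier_column_tensor by auto
  have "b = map (\<lambda>C. hw_column (length C)) b" using cols assms(2,3)
  proof (induction b rule: rev_induct)
    case Nil
    show ?case by simp
  next
    case (snoc C b)
    have C: "sorted_wrt (<) C" "set C \<subseteq> {1..Suc r}" using snoc.prems(1) by auto
    have "word_eps i (concat b) = 0" if "i \<in> {1..r}" for i
      using word_eps_prefix[of i "concat b" C] snoc.prems(3) that by auto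
    then have b: "b = map (\<lambda>C. hw_column (length C)) b"
      using snoc.prems by (intro snoc.IH) (auto simp: successively_append_iff)
    \<comment> \<open>The length of the column next to \<open>C\<close>, which bounds all letters to the right of \<open>C\<close>.\<close>
    define d where "d = (if b = [] then 0 else length (last b))"
    have letters: "x \<le> d" if h: "x \<in> set (concat b)" for x
    proof -
      obtain D where D: "D \<in> set b" "x \<in> set D" using h by auto
      then have "D \<in> set (map (\<lambda>C. hw_column (length C)) b)" using b by simp
      then obtain E :: column where E: "D = hw_column (length E)" by (auto simp del: upt_Suc)
      then have "x \<le> length D" using D(2) by (simp add: less_Suc_eq_le del: upt_Suc)
      moreover have "sorted (map length b)"
        by (rule row_le_length_sorted) (use snoc.prems(2) in \<open>simp add: successively_append_iff\<close>)
      then have "length D \<le> length (last b)"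
        using D(1) by (cases b rule: rev_cases) (auto simp: sorted_append)
      ultimately show ?thesis using D(1) unfolding d_def by auto
    qed
    have top: "C ! k \<le> Suc k" if "k < d" for k
    proof -
      have ne: "b \<noteq> []" "k < length (last b)" using that unfolding d_def by (auto split: if_splits)
      have "row_le (last b) C" using snoc.prems(2) ne(1) by (simp add: successively_append_iff)
      then have "C ! k \<le> last b ! k" using ne(2) unfolding row_le_def by blast
      moreover have "last b = hw_column (length (last b))"
        using last_in_set[OF ne(1)] b by (metis (no_types, lifting) last_map ne(1))
      then have "last b ! k = hw_column (length (last b)) ! k" by simp
      ultimately show ?thesis using ne(2) by (simp del: upt_Suc)
    qed
    have "C ! k = Suc k" if "k < length C" for k
      using that
    proof (induction k rule: less_induct)
      case (less k)
      show ?case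
      proof (rule ccontr)
        assume ne: "C ! k \<noteq> Suc k"
        have "set C \<subseteq> {1..}" using C(2) by auto
        from strict_column_nth[OF C(1) this less.prems] ne have gt: "Suc k < C ! k" by simp
        then have kd: "d \<le> k" using top[of k] by (cases "k < d") auto
        \<comment> \<open>The letter \<open>i + 1\<close> in row \<open>k\<close> has no \<open>i\<close> to be matched with.\<close>
        define i where "i = C ! k - 1"
        have x: "C ! k = Suc i" "k < i" using gt unfolding i_def by auto
        have "C ! k \<in> set C" using less.prems by simp
        then have i: "i \<in> {1..r}" "Suc i \<in> set C" using C(2) x by auto
        have "i \<notin> set C"
        proof
          assume "i \<in> set C"
          then obtain l where l: "l < length C" "C ! l = i" by (metis in_set_conv_nth)
          have "l < k"
          proof (rule ccontr)
            assume "\<not> l < k"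
            then have "C ! k \<le> C ! l"
              using sorted_wrt_nth_less[OF C(1), of k l] l(1) by (cases "l = k") auto
            then show False using l x by simp
          qed
          then have "C ! l = Suc l" using less.IH less.prems by simp
          then show False using l(2) x(2) \<open>l < k\<close> by simp
        qed
        moreover have "i \<notin> set (concat b)" using letters[of i] kd x(2) by auto
        ultimately have "count (mset (concat (b @ [C]))) i = 0" "count (mset (concat (b @ [C]))) (Suc i) > 0"
          using i(2) by (auto simp: count_eq_zero_iff)
        then show False
          using word_eps_count[of i "concat (b @ [C])"] bspec[OF snoc.prems(3) i(1)] by linarith
      qed
    qed
    then have "C = hw_column (length C)" by (intro nth_equalityI) (simp_all del: upt_Suc)
    with b show ?case by (simp only: map_append list.map)
  qed
  then show ?thesis unfolding ks by (simp add: comp_def del: upt_Suc)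
qed

text \<open>The letter $m$ occurs once for each column of length at least $m$.\<close>

lemma hw_word_determines_lengths:
  assumes "mset (hw_word ks) = mset (hw_word ks')" "0 \<notin> set ks" "0 \<notin> set ks'"
  shows "mset ks = mset ks'"
proof (rule multiset_eqI)
  have cnt: "count (mset (hw_word ks)) m = count (mset (hw_word ks)) (Suc m) + count (mset ks) m"
    if "0 < m" for m ks
  proof (induction ks)
    case (Cons k ks)
    have "count (mset (hw_column k)) x = (if x \<in> {1..k} then 1 else 0)" for x
      using distinct_count_atmost_1[of "hw_column k"] by (simp add: less_Suc_eq_le del: upt_Suc)
    then show ?case using Cons that by (auto simp del: upt_Suc)
  qed simp
  show "count (mset ks) m = count (mset ks') m" for m
  proof (cases "m = 0")
    case True
    then show ?thesis using assms(2,3) by (metis count_eq_zero_iff set_mset_mset)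
  next
    case False
    then show ?thesis using cnt[of m ks] cnt[of m ks'] assms(1) by simp
  qed
qed

lemma young_tableau_row_le:
  assumes T: "skew_tableau r T" and young: "young_diagram (dom T)"
  shows "successively row_le (rev (columns T))"
proof -
  obtain h m where h: "column_heights (dom T) h"
    and col: "columns T = map (column_at T) [0..<m]"
      "\<And>j. column_at T j = map (\<lambda>i. the (T (i, j))) [0..<h j]"
    by (rule young_filling_columns[OF young]) (rule that)
  have dom: "(i, j) \<in> dom T \<longleftrightarrow> i < h j" and anti: "j \<le> j' \<Longrightarrow> h j' \<le> h j" for i j j'
    using h unfolding column_heights_def antimono_def by blast+
  have E: "tableau_entries r T" using T unfolding skew_tableau_iff by blast
  have "row_le (column_at T (Suc j)) (column_at T j)" for j
    unfolding row_le_def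
  proof (intro conjI allI impI)
    have le: "h (Suc j) \<le> h j" by (rule anti) simp
    then show "length (column_at T (Suc j)) \<le> length (column_at T j)" unfolding col by simp
    fix k assume "k < length (column_at T (Suc j))"
    then have k: "k < h (Suc j)" "k < h j" using le unfolding col by auto
    then obtain x y where "T (k, j) = Some x" "T (k, Suc j) = Some y"
      using dom[of k j] dom[of k "Suc j"] by auto
    then show "column_at T j ! k \<le> column_at T (Suc j) ! k"
      using k tableau_entries_row[OF E, of k j x "Suc j" y] unfolding col by simp
  qed
  then show ?thesis
    unfolding successively_rev col(1) successively_map by (simp add: successively_conv_nth)
qed

text \<open>
  The path from \<open>b\<close> to the highest weight element, followed from \<open>T\<close> inside the crystal of
  tableaux, ends in a highest weight tableau, hence in columns $(1,\dots,k)$. Its content gives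
  the shape of \<open>T\<close>, so that \<open>b\<close> and \<open>T\<close> lie in the same tensor product, where an equivalent
  partner of \<open>b\<close> is unique.
\<close>

theorem rectification_unique:
  assumes ks: "sorted ks" "set ks \<subseteq> {1..r}"
    and b: "b \<in> component r (column_tensor r ks) (map hw_column ks)"
    and T: "skew_tableau r T" "young_diagram (dom T)" and eq: "concat b \<approx> column_word T"
  shows "rev (columns T) = b"
proof -
  let ?c = "rev (columns T)"
  define ks' where "ks' = map length ?c"
  have c: "?c \<in> carrier (column_tensor r ks')"
    unfolding ks'_def by (rule skew_tableau_columns(2)[OF T(1)])
  then have c': "?c \<in> carrier (tableau_crystal r ks')"
    using young_tableau_row_le[OF T] by simp
  obtain c0 where c0: "c0 \<in> component r (tableau_crystal r ks') ?c" "hw_word ks \<approx> concat c0"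
    using component_transfer[OF reads_column_tensor reads_tableau_crystal c' eq component_sym[OF b]] .
  have "c0 \<in> carrier (tableau_crystal r ks')"
    using component_carrier[OF c'] c0(1) by blast
  then have c0': "c0 \<in> carrier (column_tensor r ks')" "successively row_le c0" by simp_all
  have "\<forall>i\<in>{1..r}. word_eps i (concat c0) = 0"
    using knuth_crystal_sim[OF c0(2)] word_eps_hw_word[of _ ks] unfolding crystal_sim_def by auto
  with hw_tableau[OF c0'] have c0_hw: "c0 = map hw_column ks'" by blast
  have "mset ks = mset ks'"
  proof (rule hw_word_determines_lengths)
    show "mset (hw_word ks) = mset (hw_word ks')" using knuth_mset[OF c0(2)] unfolding c0_hw .
    show "0 \<notin> set ks" using ks(2) by auto
    show "0 \<notin> set ks'" using skew_tableau_columns(1)[OF T(1)] unfolding ks'_def by auto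
  qed
  moreover have "sorted ks'"
    unfolding ks'_def by (rule row_le_length_sorted[OF young_tableau_row_le[OF T]])
  ultimately have "ks' = ks" using ks(1) by (metis properties_for_sort sorted_sort_id)
  then have c: "?c \<in> carrier (column_tensor r ks)" using c by simp
  have "b \<in> carrier (column_tensor r ks)"
    using component_carrier[OF hw_columns_carrier[OF ks(2)]] b by blast
  then show ?thesis
    using cartan_knuth_unique[OF ks(2) refl b c _ eq knuth_refl] by blast
qed

section \<open>The left key\<close>

text \<open>The depth at which column \<open>j\<close> ends when each column starts right below all columns to its right.\<close>

definition boxes_from :: "column list \<Rightarrow> nat \<Rightarrow> nat" where
  "boxes_from Cs j = sum_list (map length (drop j Cs))"

text \<open>
  The columns placed from bottom left to top right such that no two of them share a row. Any list
  of columns becomes a skew tableau in this way.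
\<close>

definition staircase :: "column list \<Rightarrow> filling" where
  "staircase Cs = (\<lambda>(i, j). if boxes_from Cs (Suc j) \<le> i \<and> i < boxes_from Cs j
     then Some (Cs ! j ! (i - boxes_from Cs (Suc j))) else None)"

lemma boxes_from_nth: "j < length Cs \<Longrightarrow> boxes_from Cs j = length (Cs ! j) + boxes_from Cs (Suc j)"
  unfolding boxes_from_def by (simp add: Cons_nth_drop_Suc[symmetric])

lemma boxes_from_outside: "length Cs \<le> j \<Longrightarrow> boxes_from Cs j = 0"
  unfolding boxes_from_def by simp

lemma boxes_from_Suc: "boxes_from Cs (Suc j) \<le> boxes_from Cs j"
  using boxes_from_nth[of j Cs] boxes_from_outside[of Cs "Suc j"] by (cases "j < length Cs") auto

lemma boxes_from_antimono: "j \<le> j' \<Longrightarrow> boxes_from Cs j' \<le> boxes_from Cs j"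
  by (rule lift_Suc_antimono_le[where f = "boxes_from Cs", OF boxes_from_Suc])

lemma young_boxes_from: "young_diagram {(i, j). i < boxes_from Cs (d + j)}"
  unfolding young_diagram_def
proof (intro conjI allI impI)
  have "{(i, j). i < boxes_from Cs (d + j)} \<subseteq> {..<boxes_from Cs 0} \<times> {..<length Cs}"
  proof clarify
    fix i j assume i: "i < boxes_from Cs (d + j)"
    then have "i < boxes_from Cs 0" using boxes_from_antimono[of 0 "d + j" Cs] by simp
    moreover have "j < length Cs" using i boxes_from_outside[of Cs "d + j"] by (cases "j < length Cs") auto
    ultimately show "i \<in> {..<boxes_from Cs 0} \<and> j \<in> {..<length Cs}" by simp
  qed
  then show "finite {(i, j). i < boxes_from Cs (d + j)}" by (rule finite_subset) simp
  show "(i', j') \<in> {(i, j). i < boxes_from Cs (d + j)}"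
    if "(i, j) \<in> {(i, j). i < boxes_from Cs (d + j)}" "i' \<le> i" "j' \<le> j" for i j i' j'
    using that boxes_from_antimono[of "d + j'" "d + j" Cs] by auto
qed

lemma dom_staircase:
  "dom (staircase Cs) = {(i, j). boxes_from Cs (Suc j) \<le> i \<and> i < boxes_from Cs j}"
  unfolding staircase_def by (auto split: if_splits)

lemma staircase_Some:
  assumes "staircase Cs (i, j) = Some x"
  shows "j < length Cs" "i - boxes_from Cs (Suc j) < length (Cs ! j)"
    "x = Cs ! j ! (i - boxes_from Cs (Suc j))" "boxes_from Cs (Suc j) \<le> i" "i < boxes_from Cs j"
proof -
  show *: "boxes_from Cs (Suc j) \<le> i" "i < boxes_from Cs j"
    "x = Cs ! j ! (i - boxes_from Cs (Suc j))"
    using assms unfolding staircase_def by (auto split: if_splits)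
  show j: "j < length Cs" using *(2) boxes_from_outside[of Cs j] by (cases "j < length Cs") auto
  show "i - boxes_from Cs (Suc j) < length (Cs ! j)" using * boxes_from_nth[OF j] by simp
qed

lemma skew_tableau_staircase:
  assumes "\<And>C. C \<in> set Cs \<Longrightarrow> sorted_wrt (<) C \<and> set C \<subseteq> {1..Suc r}"
  shows "skew_tableau r (staircase Cs)"
  unfolding skew_tableau_iff
proof
  have "skew_shape (dom (staircase Cs)) {(i, j). i < boxes_from Cs (0 + j)} {(i, j). i < boxes_from Cs (1 + j)}"
    unfolding skew_shape_def using young_boxes_from[of Cs 0] young_boxes_from[of Cs 1]
      boxes_from_Suc[of Cs] by (auto simp: dom_staircase intro: less_le_trans)
  then show "\<exists>outer inner. skew_shape (dom (staircase Cs)) outer inner" by blast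
  show "tableau_entries r (staircase Cs)"
    unfolding tableau_entries_def
  proof (intro conjI allI impI)
    show "ran (staircase Cs) \<subseteq> {1..Suc r}"
    proof
      fix x assume "x \<in> ran (staircase Cs)"
      then obtain i j where "staircase Cs (i, j) = Some x" by (auto simp: ran_def)
      from staircase_Some[OF this] have "x \<in> set (Cs ! j)" "Cs ! j \<in> set Cs" by auto
      then show "x \<in> {1..Suc r}" using assms by blast
    qed
  next
    fix i j j' x y assume "staircase Cs (i, j) = Some x" "staircase Cs (i, j') = Some y" "j < j'"
    from staircase_Some(4)[OF this(1)] staircase_Some(5)[OF this(2)] this(3)
    show "x \<le> y" using boxes_from_antimono[of "Suc j" j' Cs] by simp
  next
    fix i i' j x y assume h: "staircase Cs (i, j) = Some x" "staircase Cs (i', j) = Some y" "i < i'"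
    note a = staircase_Some[OF h(1)] and b = staircase_Some[OF h(2)]
    have "sorted_wrt (<) (Cs ! j)" using assms a(1) by simp
    then show "x < y" unfolding a(3) b(3) by (rule sorted_wrt_nth_less) (use a b h(3) in auto)
  qed
qed

lemma columns_staircase:
  assumes "[] \<notin> set Cs"
  shows "columns (staircase Cs) = Cs"
proof -
  have ne: "0 < length (Cs ! j)" if "j < length Cs" for j
    using that assms nth_mem by fastforce
  have "snd ` dom (staircase Cs) = {0..<length Cs}"
  proof
    show "snd ` dom (staircase Cs) \<subseteq> {0..<length Cs}"
      using staircase_Some(1) by (fastforce simp: dom_def)
    show "{0..<length Cs} \<subseteq> snd ` dom (staircase Cs)"
    proof
      fix j assume "j \<in> {0..<length Cs}"
      then have "(boxes_from Cs (Suc j), j) \<in> dom (staircase Cs)"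
        unfolding dom_staircase using ne[of j] boxes_from_nth[of j Cs] by simp
      then show "j \<in> snd ` dom (staircase Cs)" by (metis imageI snd_conv)
    qed
  qed
  moreover have "column_at (staircase Cs) j = Cs ! j" if "j < length Cs" for j
  proof -
    have "column_at (staircase Cs) j =
        map (\<lambda>i. the (staircase Cs (i, j))) [boxes_from Cs (Suc j)..<boxes_from Cs j]"
      by (rule column_at_eq) (auto simp: dom_staircase)
    also have "\<dots> = Cs ! j"
      by (rule nth_equalityI) (use boxes_from_nth[OF that] in \<open>auto simp: staircase_def\<close>)
    finally show ?thesis .
  qed
  ultimately show ?thesis
    unfolding columns_def by (intro nth_equalityI) simp_all
qed

text \<open>
  The last factor of an element of a Cartan component splits off, and the rest lies in the
  Cartan component of the remaining columns.
\<close>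

lemma cartan_split:
  assumes ks: "set ks \<subseteq> {1..r}" and perm: "mset (l @ [i]) = mset ks"
    and b: "b \<in> component r (column_tensor r ks) (map hw_column ks)"
  obtains x C where "x \<in> component r (column_tensor r l) (map hw_column l)"
    "x @ [C] \<in> carrier (column_tensor r (l @ [i]))" "concat b \<approx> concat (x @ [C])"
proof -
  let ?u = "map hw_column l"
  let ?Y = "tensor ((column_tensor r l)\<lparr>carrier := component r (column_tensor r l) ?u\<rparr>) (column_crystal r i)"
  let ?f = "\<lambda>(x, C). concat x @ C"
  have l: "set l \<subseteq> {1..r}" "i \<in> {1..r}" using ks mset_eq_setD[OF perm] by auto
  note u = hw_columns_carrier[OF l(1)]
  have Y: "reads r ?Y ?f"
    by (rule reads_tensor[OF reads_component[OF reads_column_tensor u] reads_column_crystal])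
  have cY: "carrier ?Y = component r (column_tensor r l) ?u \<times> carrier (column_crystal r i)"
    by (simp add: tensor_def)
  have v: "(?u, hw_column i) \<in> carrier ?Y"
    unfolding cY carrier_column_crystal using l(2) component_refl[of ?u r] by (auto simp del: upt_Suc)
  have uv: "hw_word ks \<approx> ?f (?u, hw_column i)"
    using hw_words_permute[OF perm[symmetric]] by simp
  obtain c where c: "c \<in> component r ?Y (?u, hw_column i)" "concat b \<approx> ?f c"
    using component_transfer[OF reads_column_tensor Y v uv b] .
  obtain x C where xC: "c = (x, C)" by fastforce
  have "c \<in> carrier ?Y" using c(1) component_carrier[OF v] by blast
  then have x: "x \<in> component r (column_tensor r l) ?u" and C: "C \<in> carrier (column_crystal r i)"
    unfolding xC cY by auto
  have "x \<in> carrier (column_tensor r l)" using x component_carrier[OF u] by blast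
  then have "x @ [C] \<in> carrier (column_tensor r (l @ [i]))"
    using C unfolding carrier_column_tensor carrier_column_crystal by simp
  then show ?thesis using that[of x C] x c(2) xC by simp
qed

text \<open>
  The staircase of \<open>x @ [C]\<close> witnesses that \<open>C\<close> is a leftmost column; all other frank skew tableaux
  for the same \<open>T\<close> yield lists \<open>y @ [D]\<close> with \<open>y\<close> in the Cartan component for another order of
  the lengths, which is matched with the order of \<open>x\<close>.
\<close>

theorem left_key_column_eq:
  assumes ks: "sorted ks" "set ks \<subseteq> {1..r}" and i: "i \<in> set ks"
    and b: "b \<in> component r (column_tensor r ks) (map hw_column ks)"
    and x: "x @ [C] \<in> carrier (column_tensor r (remove1 i ks @ [i]))"
    and eq: "concat b \<approx> concat (x @ [C])"
  shows "left_key_column r (of_columns (rev b)) i = C"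
proof -
  let ?l = "remove1 i ks" and ?T = "of_columns (rev b)"
  have perm: "mset ks = mset (?l @ [i])" using i by simp
  have bC: "b \<in> carrier (column_tensor r ks)"
    using component_carrier[OF hw_columns_carrier[OF ks(2)]] b by blast
  then have lb: "map length b = ks" unfolding carrier_column_tensor by simp
  have "[] \<notin> set (rev b)" using lb ks(2) by (force simp flip: lb)
  then have colT: "columns ?T = rev b" by (rule columns_of_columns)
  \<comment> \<open>All rectifications that occur below are the tableau of \<open>b\<close>; this covers the tableau in the
    definition of frankness as well.\<close>
  have rect: "T' = ?T" if "skew_tableau r S" "rectifies_to S T'" "concat b \<approx> column_word S" for S T'
  proof -
    have T': "jdt_slide\<^sup>*\<^sup>* S T'" "young_diagram (dom T')" using that(2) unfolding rectifies_to_def by auto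
    have "skew_tableau r T'" "column_word S \<approx> column_word T'" using jdt_knuth[OF T'(1) that(1)] by auto
    then have "rev (columns T') = b"
      using rectification_unique[OF ks b _ T'(2)] knuth_trans[OF that(3)] by blast
    then have "columns T' = rev b" by auto
    then show ?thesis using of_columns_columns[OF T'(2)] by simp
  qed
  show ?thesis unfolding left_key_column_def
  proof (rule the_equality)
    let ?S = "staircase (rev (x @ [C]))"
    have xC: "map length (x @ [C]) = ?l @ [i]"
      "\<forall>D\<in>set (x @ [C]). sorted_wrt (<) D \<and> set D \<subseteq> {1..Suc r}"
      using x unfolding carrier_column_tensor by auto
    have "set (map length (x @ [C])) \<subseteq> {1..r}"
      unfolding xC(1) using ks(2) i by (auto dest: notin_set_remove1)
    then have "[] \<notin> set (rev (x @ [C]))" by force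
    then have colS: "columns ?S = rev (x @ [C])" by (rule columns_staircase)
    have S: "skew_tableau r ?S" by (rule skew_tableau_staircase) (use xC(2) in auto)
    obtain T' where "rectifies_to ?S T'" using rectification_exists[OF S] by blast
    moreover have "concat b \<approx> column_word ?S" using eq unfolding colS by simp
    ultimately have R: "rectifies_to ?S ?T" using rect[OF S] by metis
    have "mset (map length (columns ?S)) = mset (map length (columns ?T))"
    proof -
      have "mset (map length (columns ?S)) = mset (map length (x @ [C]))" unfolding colS by simp
      also have "\<dots> = mset (map length b)" unfolding xC(1) lb perm ..
      finally show ?thesis unfolding colT by simp
    qed
    then have "frank ?S" using R unfolding frank_def by blast
    moreover have "C = hd (columns ?S)" unfolding colS by simp
    moreover have "length C = i" using xC(1) by simp
    ultimately show "\<exists>S. skew_tableau r S \<and> frank S \<and> rectifies_to S ?T \<and> C = hd (columns S) \<and> length C = i"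
      using S R by blast
  next
    fix D
    assume "\<exists>S. skew_tableau r S \<and> frank S \<and> rectifies_to S ?T \<and> D = hd (columns S) \<and> length D = i"
    then obtain S where S: "skew_tableau r S" "frank S" "rectifies_to S ?T" "D = hd (columns S)" "length D = i"
      by blast
    have "column_word S \<approx> column_word ?T" using jdt_knuth[of S ?T] S(1,3) unfolding rectifies_to_def by blast
    then have bS: "concat b \<approx> column_word S" unfolding colT by (simp add: knuth_sym)
    obtain T' where "rectifies_to S T'" "mset (map length (columns S)) = mset (map length (columns T'))"
      using S(2) unfolding frank_def by blast
    then have "mset (map length (columns S)) = mset (map length (rev b))"
      using rect[OF S(1) _ bS] colT by metis
    then have mS: "mset (map length (rev (columns S))) = mset ks" unfolding lb[symmetric] by simp
    then have "columns S \<noteq> []" using i by auto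
    then obtain y where y: "rev (columns S) = y @ [D]" using S(4) by (cases "columns S") auto
    define l where "l = map length y"
    have li: "map length (rev (columns S)) = l @ [i]" unfolding y l_def using S(5) by simp
    have yD: "y @ [D] \<in> carrier (column_tensor r (l @ [i]))"
      using skew_tableau_columns(2)[OF S(1)] unfolding li unfolding y .
    have permS: "mset (l @ [i]) = mset ks" using mS unfolding li .
    obtain x0 C0 where x0: "x0 \<in> component r (column_tensor r l) (map hw_column l)"
        "x0 @ [C0] \<in> carrier (column_tensor r (l @ [i]))" "concat b \<approx> concat (x0 @ [C0])"
      using cartan_split[OF ks(2) permS b] .
    have "x0 @ [C0] = y @ [D]"
      using cartan_knuth_unique[OF ks(2) permS[symmetric] b x0(2) yD x0(3)] bS unfolding y by simp
    then have x0y: "x0 = y" "C0 = D" by simp_all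
    have l: "set l \<subseteq> {1..r}" using ks(2) mset_eq_setD[OF permS] by auto
    \<comment> \<open>Sort the remaining columns: replace \<open>y\<close> by its partner \<open>x1\<close> in the order of \<open>x\<close>.\<close>
    have "mset (l @ [i]) = mset (?l @ [i])" using permS perm by (rule trans)
    then have "mset l = mset ?l" by (simp only: mset_append add_right_cancel)
    from cartan_transfer[OF l this x0(1)]
    obtain x1 where x1: "x1 \<in> component r (column_tensor r ?l) (map hw_column ?l)" "concat x0 \<approx> concat x1" .
    have "set ?l \<subseteq> {1..r}" using ks(2) by (auto dest: notin_set_remove1)
    then have "x1 \<in> carrier (column_tensor r ?l)"
      using subsetD[OF component_carrier[OF hw_columns_carrier] x1(1)] by simp
    then have x1C: "x1 @ [D] \<in> carrier (column_tensor r (?l @ [i]))"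
      using yD unfolding carrier_column_tensor by auto
    have "concat b \<approx> concat (x1 @ [D])"
      using knuth_trans[OF x0(3)] knuth_append2[OF x1(2), of D] x0y(2) by simp
    then have "x1 @ [D] = x @ [C]"
      by (rule cartan_knuth_unique[OF ks(2) perm b x1C x _ eq])
    then show "D = C" by simp
  qed
qed

theorem theorem6p9:
  fixes r :: nat and lam :: weight and ind :: "nat list"
    and b :: "column list" and T :: filling
  assumes "1 \<le> r"
    and "dominant r lam"
    and "sorted ind" and "set ind \<subseteq> {1..r}"
    and "lam = (\<lambda>j. \<Sum>i\<leftarrow>ind. fund i j)"
    and "b \<in> carrier (hw_crystal r lam)"
    and "T = of_columns (rev b)"
  shows "map (\<lambda>i. right_end r lam (fund i) b) ind
           = map (\<lambda>C. [C]) (rev (columns (left_key r T))) \<and>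
         (\<forall>k < length ind. \<exists>C \<in> set (columns (left_key r T)).
            length C = ind ! k \<and> right_end r lam (fund (ind ! k)) b = [C] \<and>
            (\<forall>C' \<in> set (columns (left_key r T)). length C' = ind ! k \<longrightarrow> C' = C))"
proof -
  note ind = assms(3,4)
  have b: "b \<in> component r (column_tensor r ind) (map hw_column ind)"
    using assms(6) unfolding hw_crystal_sum[OF ind assms(5)] by simp
  let ?L = "left_key_column r T"
  have key: "right_end r lam (fund i) b = [?L i] \<and> length (?L i) = i" if i: "i \<in> set ind" for i
  proof -
    obtain x C where x: "right_end r lam (fund i) b = [C]"
        "x @ [C] \<in> carrier (column_tensor r (remove1 i ind @ [i]))" "concat b \<approx> concat (x @ [C])"
      using right_end_knuth[OF ind i assms(5) b] .
    have "?L i = C" unfolding assms(7) by (rule left_key_column_eq[OF ind i b x(2,3)])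
    moreover have "length C = i" using x(2) unfolding carrier_column_tensor by simp
    ultimately show ?thesis using x(1) by simp
  qed
  have "b \<in> carrier (column_tensor r ind)"
    using component_carrier[OF hw_columns_carrier[OF ind(2)]] b by blast
  then have lb: "map length b = ind" unfolding carrier_column_tensor by simp
  have ind0: "0 \<notin> set ind" using ind(2) by auto
  then have "[] \<notin> set (rev b)" unfolding lb[symmetric] by force
  then have "columns T = rev b" unfolding assms(7) by (rule columns_of_columns)
  then have lk: "left_key r T = of_columns (rev (map ?L ind))"
    unfolding left_key_def lb[symmetric] by (simp add: rev_map comp_def)
  have "[] \<notin> set (rev (map ?L ind))"
    using key ind0 by (metis (no_types, lifting) imageE length_0_conv list.set_map set_rev)
  then have cols: "columns (left_key r T) = rev (map ?L ind)" unfolding lk by (rule columns_of_columns)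
  show ?thesis
  proof (intro conjI allI impI)
    show "map (\<lambda>i. right_end r lam (fund i) b) ind = map (\<lambda>C. [C]) (rev (columns (left_key r T)))"
      unfolding cols using key by simp
    fix k assume "k < length ind"
    then have k: "ind ! k \<in> set ind" by simp
    show "\<exists>C \<in> set (columns (left_key r T)).
            length C = ind ! k \<and> right_end r lam (fund (ind ! k)) b = [C] \<and>
            (\<forall>C' \<in> set (columns (left_key r T)). length C' = ind ! k \<longrightarrow> C' = C)"
    proof (intro bexI conjI ballI impI)
      show "?L (ind ! k) \<in> set (columns (left_key r T))" unfolding cols using k by simp
      show "length (?L (ind ! k)) = ind ! k" "right_end r lam (fund (ind ! k)) b = [?L (ind ! k)]"
        using key[OF k] by auto
      fix C' assume "C' \<in> set (columns (left_key r T))" "length C' = ind ! k"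
      then show "C' = ?L (ind ! k)" unfolding cols using key by auto
    qed
  qed
qed

end
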